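(* Let $T=(T_1,\ldots,T_k)\in B(\mathcal H)^{n_1}\times\cdots\times B(\mathcal H)^{n_k}$. Then $T$ is a pure element in the regular $\Lambda$-polyball such that $\operatorname{rank}\Delta_T(I)=1$ if and only if there is a jointly co-invariant subspace $\mathcal M\subset\ell^2(\mathbb F_{n_1}^+\times\cdots\times\mathbb F_{n_k}^+)$ under the isometries $S_{i,s}$, where $i\in\{1,\ldots,k\}$ and $s\in\{1,\ldots,n_i\}$, such that $T$ is jointly unitarily equivalent to the compression $P_{\mathcal M}S|_{\mathcal M}:=(P_{\mathcal M}S_1|_{\mathcal M},\ldots,P_{\mathcal M}S_k|_{\mathcal M})$, where $$P_{\mathcal M}S_i|_{\mathcal M}:=[P_{\mathcal M}S_{i,1}|_{\mathcal M}\cdots P_{\mathcal M}S_{i,n_i}|_{\mathcal M}].$$ If $\mathcal M'$ is another jointly co-invariant subspace under $S_{i,s}$, then $P_{\mathcal M}S|_{\mathcal M}$ and $P_{\mathcal M'}S|_{\mathcal M'}$ are unitarily equivalent if and only if $\mathcal M=\mathcal M'$.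
   Context: Fix integers $k\ge1$, $n_1,\ldots,n_k\ge 1$ and, for $i\ne j$ in $\{1,\ldots,k\}$, an $n_i\times n_j$ matrix $\Lambda_{i,j}=[\lambda_{i,j}(s,t)]$ with entries in $\mathbb T=\{z\in\mathbb C:|z|=1\}$, such that $\lambda_{j,i}(t,s)=\overline{\lambda_{i,j}(s,t)}$. $\mathcal H$ is a Hilbert space. For $T=(T_1,\ldots,T_k)$ with $T_i=[T_{i,1}\cdots T_{i,n_i}]$, $T_{i,s}\in B(\mathcal H)$, and $r\in[0,1]$, let $\Phi_{rT_i}(X):=\sum_{s=1}^{n_i}r^2T_{i,s}XT_{i,s}^*$ for $X\in B(\mathcal H)$ and $\Delta_{rT}(I):=(id-\Phi_{rT_1})\circ\cdots\circ(id-\Phi_{rT_k})(I)$; $\Delta_T(I)$ is the case $r=1$. The regular $\Lambda$-polyball is the set of $T$ with $\sum_sT_{i,s}T_{i,s}^*\le I$ for each $i$, $T_{i,s}T_{j,t}=\lambda_{i,j}(s,t)T_{j,t}T_{i,s}$ for all $i\ne j$, $s,t$, and $\Delta_{rT}(I)\ge0$ for all $r\in[0,1)$. $T$ is pure if $\Phi_{T_i}^q(I)\to0$ strongly as $q\to\infty$ for each $i$. $\mathbb F_{n_i}^+$ is the unital free semigroup with generators $g_1^i,\ldots,g_{n_i}^i$ and neutral element $g_0^i$. The universal standard $k$-tuple $S=(S_1,\ldots,S_k)$, $S_i=[S_{i,1}\cdots S_{i,n_i}]$, acts on $\ell^2(\mathbb F_{n_1}^+\times\cdots\times\mathbb F_{n_k}^+)$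 with standard basis $\chi_{(\alpha_1,\ldots,\alpha_k)}$ by $$S_{i,s}\chi_{(\alpha_1,\ldots,\alpha_k)}=\boldsymbol\lambda_{i,1}(s,\alpha_1)\cdots\boldsymbol\lambda_{i,i-1}(s,\alpha_{i-1})\chi_{(\alpha_1,\ldots,\alpha_{i-1},g_s^i\alpha_i,\alpha_{i+1},\ldots,\alpha_k)},$$ where $\boldsymbol\lambda_{i,j}(s,g^j_{j_1}\cdots g^j_{j_q})=\prod_{b=1}^q\lambda_{i,j}(s,j_b)$, $\boldsymbol\lambda_{i,j}(s,g_0^j)=1$ (no factor if $i=1$). Co-invariant means invariant under all adjoints $S_{i,s}^*$; subspaces are closed. Joint unitary equivalence means a single unitary intertwines all corresponding entries. $P_{\mathcal M}$ is the orthogonal projection onto $\mathcal M$.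
   Formalization: The Hilbert space H is assumed nonzero: for H = {0}, T is unitarily equivalent to the compression to the co-invariant subspace M = {0}, but the rank of Δ_T(I) is 0, so the stated equivalence fails there. *)

theory Defs
  imports "HOL-Analysis.Analysis" "HOL-Library.Nonpos_Ints"
begin

section \<open>Complex Hilbert spaces\<close>

class complex_vector = real_vector +
  fixes scaleC :: "complex \<Rightarrow> 'a \<Rightarrow> 'a" (infixr \<open>*\<^sub>C\<close> 75)
  assumes scaleC_add_right: "a *\<^sub>C (x + y) = a *\<^sub>C x + a *\<^sub>C y"
    and scaleC_add_left: "(a + b) *\<^sub>C x = a *\<^sub>C x + b *\<^sub>C x"
    and scaleC_scaleC: "a *\<^sub>C (b *\<^sub>C x) = (a * b) *\<^sub>C x"
    and scaleC_one: "1 *\<^sub>C x = x"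
    and scaleR_scaleC: "r *\<^sub>R x = complex_of_real r *\<^sub>C x"

global_interpretation complex_vector: vector_space "scaleC :: complex \<Rightarrow> 'a \<Rightarrow> 'a::complex_vector"
  defines csubspace = complex_vector.subspace
    and cdim = complex_vector.dim
  by unfold_locales (simp_all add: scaleC_add_right scaleC_add_left scaleC_scaleC scaleC_one)

text \<open>The inner product is linear in its first argument. The library classes supply the norm
  and its topology, so the only link to state is that the norm is the one of the inner product;
  positive definiteness of \<open>cinner\<close> follows from it.\<close>

class complex_inner = complex_vector + real_normed_vector +
  fixes cinner :: "'a \<Rightarrow> 'a \<Rightarrow> complex"
  assumes cinner_commute: "cinner x y = cnj (cinner y x)"
    and cinner_add_left: "cinner (x + y) z = cinner x z + cinner y z"
    and cinner_scaleC_left: "cinner (c *\<^sub>C x) y = c * cinner x y"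
    and cinner_self: "cinner x x = complex_of_real ((norm x)\<^sup>2)"

class chilbert_space = complex_inner + complete_space

section \<open>The space of square-summable families\<close>

typedef 'a ell2 = "{f :: 'a \<Rightarrow> complex. (\<lambda>x. (cmod (f x))\<^sup>2) summable_on UNIV}"
  morphisms coord Abs_ell2
  by (rule exI[of _ "\<lambda>_. 0"]) simp

setup_lifting type_definition_ell2

lemma sq_summableI:
  fixes f :: "'a \<Rightarrow> complex"
  assumes "\<And>F. finite F \<Longrightarrow> (\<Sum>x\<in>F. (cmod (f x))\<^sup>2) \<le> B"
  shows "(\<lambda>x. (cmod (f x))\<^sup>2) summable_on UNIV"
  by (rule nonneg_bdd_above_summable_on) (auto intro!: bdd_aboveI2[where M = B] assms)

lemma sq_summable_add:
  fixes f g :: "'a \<Rightarrow> complex"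
  assumes f: "(\<lambda>x. (cmod (f x))\<^sup>2) summable_on UNIV"
    and g: "(\<lambda>x. (cmod (g x))\<^sup>2) summable_on UNIV"
  shows "(\<lambda>x. (cmod (f x + g x))\<^sup>2) summable_on UNIV"
proof (rule sq_summableI)
  fix F :: "'a set"
  assume F: "finite F"
  have "(cmod (f x + g x))\<^sup>2 \<le> 2 * (cmod (f x))\<^sup>2 + 2 * (cmod (g x))\<^sup>2" for x
  proof -
    have "(cmod (f x + g x))\<^sup>2 \<le> (cmod (f x) + cmod (g x))\<^sup>2"
      by (intro power_mono norm_triangle_ineq) simp
    also have "\<dots> \<le> 2 * (cmod (f x))\<^sup>2 + 2 * (cmod (g x))\<^sup>2"
      using zero_le_power2[of "cmod (f x) - cmod (g x)"]
      unfolding power2_sum power2_diff by linarith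
    finally show ?thesis .
  qed
  then have "(\<Sum>x\<in>F. (cmod (f x + g x))\<^sup>2)
      \<le> 2 * (\<Sum>x\<in>F. (cmod (f x))\<^sup>2) + 2 * (\<Sum>x\<in>F. (cmod (g x))\<^sup>2)"
    unfolding sum_distrib_left sum.distrib[symmetric] by (rule sum_mono)
  also have "\<dots> \<le> 2 * (\<Sum>\<^sub>\<infinity>x. (cmod (f x))\<^sup>2) + 2 * (\<Sum>\<^sub>\<infinity>x. (cmod (g x))\<^sup>2)"
    using finite_sum_le_infsum[OF f F] finite_sum_le_infsum[OF g F] by simp
  finally show "(\<Sum>x\<in>F. (cmod (f x + g x))\<^sup>2)
      \<le> 2 * (\<Sum>\<^sub>\<infinity>x. (cmod (f x))\<^sup>2) + 2 * (\<Sum>\<^sub>\<infinity>x. (cmod (g x))\<^sup>2)" .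
qed

lemma sq_summable_scale:
  fixes f :: "'a \<Rightarrow> complex"
  assumes "(\<lambda>x. (cmod (f x))\<^sup>2) summable_on UNIV"
  shows "(\<lambda>x. (cmod (c * f x))\<^sup>2) summable_on UNIV"
  using summable_on_cmult_right[OF assms, of "(cmod c)\<^sup>2"]
  by (simp add: norm_mult power_mult_distrib)

lemma sq_summable_product:
  fixes f g :: "'a \<Rightarrow> complex"
  assumes "(\<lambda>x. (cmod (f x))\<^sup>2) summable_on UNIV"
    and "(\<lambda>x. (cmod (g x))\<^sup>2) summable_on UNIV"
  shows "(\<lambda>x. f x * cnj (g x)) summable_on UNIV"
proof -
  have "(\<lambda>x. norm (f x * cnj (g x))) summable_on UNIV"
    by (rule abs_summable_product) (use assms in \<open>simp_all add: norm_mult power2_eq_square\<close>)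
  then show ?thesis by (rule abs_summable_summable)
qed

instantiation ell2 :: (type) complex_inner
begin

lift_definition zero_ell2 :: "'a ell2" is "\<lambda>_. 0" by simp

lift_definition plus_ell2 :: "'a ell2 \<Rightarrow> 'a ell2 \<Rightarrow> 'a ell2" is "\<lambda>f g x. f x + g x"
  by (simp add: sq_summable_add)

lift_definition uminus_ell2 :: "'a ell2 \<Rightarrow> 'a ell2" is "\<lambda>f x. - f x"
  by simp

lift_definition minus_ell2 :: "'a ell2 \<Rightarrow> 'a ell2 \<Rightarrow> 'a ell2" is "\<lambda>f g x. f x - g x"
  using sq_summable_add[where g = "\<lambda>x. - g x" for g] by simp

lift_definition scaleC_ell2 :: "complex \<Rightarrow> 'a ell2 \<Rightarrow> 'a ell2" is "\<lambda>c f x. c * f x"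
  by (rule sq_summable_scale)

definition scaleR_ell2 :: "real \<Rightarrow> 'a ell2 \<Rightarrow> 'a ell2"
  where "scaleR_ell2 r f = complex_of_real r *\<^sub>C f"

lift_definition cinner_ell2 :: "'a ell2 \<Rightarrow> 'a ell2 \<Rightarrow> complex"
  is "\<lambda>f g. \<Sum>\<^sub>\<infinity>x. f x * cnj (g x)" .

lift_definition norm_ell2 :: "'a ell2 \<Rightarrow> real"
  is "\<lambda>f. sqrt (\<Sum>\<^sub>\<infinity>x. (cmod (f x))\<^sup>2)" .

definition dist_ell2 :: "'a ell2 \<Rightarrow> 'a ell2 \<Rightarrow> real"
  where "dist_ell2 f g = norm (f - g)"

definition sgn_ell2 :: "'a ell2 \<Rightarrow> 'a ell2"
  where "sgn_ell2 f = inverse (norm f) *\<^sub>R f"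

definition uniformity_ell2 :: "('a ell2 \<times> 'a ell2) filter"
  where "uniformity_ell2 = (INF e\<in>{0<..}. principal {(f, g). dist f g < e})"

definition open_ell2 :: "'a ell2 set \<Rightarrow> bool"
  where "open_ell2 U = (\<forall>x\<in>U. eventually (\<lambda>(x', y). x' = x \<longrightarrow> y \<in> U) uniformity)"

lemma norm_ell2_power2: "(norm (f :: 'a ell2))\<^sup>2 = (\<Sum>\<^sub>\<infinity>x. (cmod (coord f x))\<^sup>2)"
  by transfer (simp add: infsum_nonneg)

lemma norm_ell2_nonneg: "0 \<le> norm (f :: 'a ell2)"
  by transfer (simp add: infsum_nonneg)

lemma L2_set_le_norm_ell2: "finite F \<Longrightarrow> L2_set (\<lambda>x. cmod (coord f x)) F \<le> norm f"
  unfolding L2_set_def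
  by transfer (auto intro!: real_sqrt_le_mono finite_sum_le_infsum)

lemma norm_ell2_leI:
  assumes "\<And>F. finite F \<Longrightarrow> L2_set (\<lambda>x. cmod (coord f x)) F \<le> B"
  shows "norm (f :: 'a ell2) \<le> B"
proof -
  have B: "0 \<le> B" using assms[of "{}"] by simp
  have "(norm f)\<^sup>2 \<le> B\<^sup>2"
    unfolding norm_ell2_power2
  proof (rule infsum_le_finite_sums)
    show "(\<lambda>x. (cmod (coord f x))\<^sup>2) summable_on UNIV" using coord[of f] by simp
    fix F :: "'a set"
    assume "finite F"
    then have "L2_set (\<lambda>x. cmod (coord f x)) F \<le> B" by (rule assms)
    then have "(L2_set (\<lambda>x. cmod (coord f x)) F)\<^sup>2 \<le> B\<^sup>2"
      by (intro power_mono L2_set_nonneg)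
    then show "(\<Sum>x\<in>F. (cmod (coord f x))\<^sup>2) \<le> B\<^sup>2"
      by (simp add: L2_set_def sum_nonneg)
  qed
  then show ?thesis using B by (rule power2_le_imp_le)
qed

instance
proof
  fix a b c :: complex and r s :: real and x y z :: "'a ell2"
  show "x + y + z = x + (y + z)" by transfer (simp add: add.assoc)
  show "x + y = y + x" by transfer (simp add: add.commute)
  show "0 + x = x" by transfer simp
  show "- x + x = 0" by transfer simp
  show "x - y = x + - y" by transfer simp
  have add_right: "a *\<^sub>C (x + y) = a *\<^sub>C x + a *\<^sub>C y" for a and x y :: "'a ell2"
    by transfer (simp add: distrib_left)
  have add_left: "(a + b) *\<^sub>C x = a *\<^sub>C x + b *\<^sub>C x" for a b and x :: "'a ell2"
    by transfer (simp add: distrib_right)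
  have assoc: "a *\<^sub>C (b *\<^sub>C x) = (a * b) *\<^sub>C x" for a b and x :: "'a ell2"
    by transfer (simp add: mult.assoc)
  have one: "1 *\<^sub>C x = x" for x :: "'a ell2"
    by transfer simp
  show "r *\<^sub>R (x + y) = r *\<^sub>R x + r *\<^sub>R y" by (simp add: scaleR_ell2_def add_right)
  show "(r + s) *\<^sub>R x = r *\<^sub>R x + s *\<^sub>R x" by (simp add: scaleR_ell2_def add_left)
  show "r *\<^sub>R s *\<^sub>R x = (r * s) *\<^sub>R x" by (simp add: scaleR_ell2_def assoc)
  show "1 *\<^sub>R x = x" by (simp add: scaleR_ell2_def one)
  show "a *\<^sub>C (x + y) = a *\<^sub>C x + a *\<^sub>C y" by (rule add_right)
  show "(a + b) *\<^sub>C x = a *\<^sub>C x + b *\<^sub>C x" by (rule add_left)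
  show "a *\<^sub>C (b *\<^sub>C x) = (a * b) *\<^sub>C x" by (rule assoc)
  show "1 *\<^sub>C x = x" by (rule one)
  show "r *\<^sub>R x = complex_of_real r *\<^sub>C x" by (rule scaleR_ell2_def)
  show "dist x y = norm (x - y)" by (rule dist_ell2_def)
  show "sgn x = inverse (norm x) *\<^sub>R x" by (rule sgn_ell2_def)
  show "uniformity = (INF e\<in>{0<..}. principal {(f, g). dist f (g :: 'a ell2) < e})"
    by (rule uniformity_ell2_def)
  show "open U = (\<forall>x\<in>U. \<forall>\<^sub>F (x', y) in uniformity. x' = x \<longrightarrow> y \<in> U)" for U :: "'a ell2 set"
    by (rule open_ell2_def)
  show "norm x = 0 \<longleftrightarrow> x = 0"
  proof
    assume 0: "norm x = 0"
    have "coord x i = 0" for i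
      using L2_set_le_norm_ell2[of "{i}" x] 0 by (simp add: L2_set_def)
    then show "x = 0" by (intro coord_inject[THEN iffD1]) (auto simp: zero_ell2.rep_eq)
  next
    assume "x = 0"
    then show "norm x = 0" by (simp add: norm_ell2.rep_eq zero_ell2.rep_eq)
  qed
  show "norm (x + y) \<le> norm x + norm y"
  proof (rule norm_ell2_leI)
    fix F :: "'a set"
    assume F: "finite F"
    have "L2_set (\<lambda>i. cmod (coord (x + y) i)) F
        \<le> L2_set (\<lambda>i. cmod (coord x i) + cmod (coord y i)) F"
      by (rule L2_set_mono) (simp_all add: plus_ell2.rep_eq norm_triangle_ineq)
    also have "\<dots> \<le> L2_set (\<lambda>i. cmod (coord x i)) F + L2_set (\<lambda>i. cmod (coord y i)) F"
      by (rule L2_set_triangle_ineq)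
    also have "\<dots> \<le> norm x + norm y"
      using L2_set_le_norm_ell2[OF F] by (intro add_mono)
    finally show "L2_set (\<lambda>i. cmod (coord (x + y) i)) F \<le> norm x + norm y" .
  qed
  show "norm (r *\<^sub>R x) = \<bar>r\<bar> * norm x"
    unfolding scaleR_ell2_def
    by transfer (simp add: norm_mult power_mult_distrib infsum_cmult_right' real_sqrt_mult)
  show "cinner x y = cnj (cinner y x)"
    by transfer (simp flip: infsum_cnj add: mult.commute)
  show "cinner (x + y) z = cinner x z + cinner y z"
    by transfer (simp add: distrib_right infsum_add sq_summable_product)
  show "cinner (c *\<^sub>C x) y = c * cinner x y"
    by transfer (simp add: mult.assoc infsum_cmult_right')
  show "cinner x x = complex_of_real ((norm x)\<^sup>2)"
    unfolding norm_ell2_power2 cinner_ell2.rep_eq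
    using coord[of x]
    by (intro infsumI) (simp only: complex_norm_square[symmetric] mem_Collect_eq has_sum_of_real has_sum_infsum)
qed

end

instance ell2 :: (type) chilbert_space
proof
  fix X :: "nat \<Rightarrow> 'a ell2"
  assume X: "Cauchy X"
  have coord_diff: "coord (f - g) i = coord f i - coord g i" for f g :: "'a ell2" and i
    by (simp add: minus_ell2.rep_eq)
  have coord_le: "cmod (coord f i) \<le> norm f" for f :: "'a ell2" and i
    using L2_set_le_norm_ell2[of "{i}" f] by (simp add: L2_set_def)
  have "Cauchy (\<lambda>n. coord (X n) i)" for i
  proof (rule metric_CauchyI)
    fix e :: real
    assume "0 < e"
    then obtain N where N: "\<forall>m\<ge>N. \<forall>n\<ge>N. dist (X m) (X n) < e"
      using metric_CauchyD[OF X] by blast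
    have "dist (coord (X m) i) (coord (X n) i) \<le> dist (X m) (X n)" for m n
      using coord_le[of "X m - X n" i] by (simp add: dist_norm coord_diff)
    then show "\<exists>N. \<forall>m\<ge>N. \<forall>n\<ge>N. dist (coord (X m) i) (coord (X n) i) < e"
      using N by (meson le_less_trans)
  qed
  then have "\<forall>i. \<exists>l. (\<lambda>n. coord (X n) i) \<longlonglongrightarrow> l"
    by (simp add: Cauchy_convergent_iff convergent_def)
  then obtain L where L: "\<And>i. (\<lambda>n. coord (X n) i) \<longlonglongrightarrow> L i"
    by metis
  have tail: "\<exists>N. \<forall>m\<ge>N. \<forall>F. finite F \<longrightarrow> L2_set (\<lambda>i. cmod (coord (X m) i - L i)) F \<le> e"
    if "0 < e" for e
  proof -
    obtain N where N: "\<forall>m\<ge>N. \<forall>n\<ge>N. dist (X m) (X n) < e"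
      using metric_CauchyD[OF X \<open>0 < e\<close>] by blast
    have "L2_set (\<lambda>i. cmod (coord (X m) i - L i)) F \<le> e" if "m \<ge> N" "finite F" for m F
    proof (rule LIMSEQ_le_const2)
      show "(\<lambda>n. L2_set (\<lambda>i. cmod (coord (X m) i - coord (X n) i)) F)
          \<longlonglongrightarrow> L2_set (\<lambda>i. cmod (coord (X m) i - L i)) F"
        unfolding L2_set_def by (intro tendsto_intros L)
      have "L2_set (\<lambda>i. cmod (coord (X m) i - coord (X n) i)) F \<le> e" if "n \<ge> N" for n
        using L2_set_le_norm_ell2[OF \<open>finite F\<close>, of "X m - X n"] N \<open>m \<ge> N\<close> that
        by (fastforce simp: coord_diff dist_norm)
      then show "\<exists>N. \<forall>n\<ge>N. L2_set (\<lambda>i. cmod (coord (X m) i - coord (X n) i)) F \<le> e"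
        by blast
    qed
    then show ?thesis by blast
  qed
  obtain N where N: "\<And>F. finite F \<Longrightarrow> L2_set (\<lambda>i. cmod (coord (X N) i - L i)) F \<le> 1"
    using tail[of 1] by auto
  have "(\<lambda>i. (cmod (L i - coord (X N) i))\<^sup>2) summable_on UNIV"
  proof (rule sq_summableI)
    fix F :: "'a set"
    assume "finite F"
    then show "(\<Sum>i\<in>F. (cmod (L i - coord (X N) i))\<^sup>2) \<le> 1"
      using N[of F] by (simp add: L2_set_def norm_minus_commute)
  qed
  from sq_summable_add[OF this, of "coord (X N)"]
  have "(\<lambda>i. (cmod (L i))\<^sup>2) summable_on UNIV"
    using coord[of "X N"] by simp
  then have coord_L: "coord (Abs_ell2 L) = L"
    by (simp add: Abs_ell2_inverse)
  have "X \<longlonglongrightarrow> Abs_ell2 L"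
  proof (rule metric_LIMSEQ_I)
    fix e :: real
    assume "0 < e"
    then obtain M where "\<forall>m\<ge>M. \<forall>F. finite F \<longrightarrow> L2_set (\<lambda>i. cmod (coord (X m) i - L i)) F \<le> e / 2"
      using tail[of "e / 2"] by auto
    then have "norm (X m - Abs_ell2 L) \<le> e / 2" if "m \<ge> M" for m
      using that by (intro norm_ell2_leI) (simp add: coord_diff coord_L)
    then show "\<exists>M. \<forall>m\<ge>M. dist (X m) (Abs_ell2 L) < e"
      using \<open>0 < e\<close> by (intro exI[of _ M]) (fastforce simp: dist_norm)
  qed
  then show "convergent X" by (rule convergentI)
qed

lift_definition chi :: "'a \<Rightarrow> 'a ell2" is "\<lambda>a x. if x = a then 1 else 0"
proof (rule sq_summableI)
  fix a :: 'a and F :: "'a set"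
  assume "finite F"
  then show "(\<Sum>x\<in>F. (cmod (if x = a then 1 else 0))\<^sup>2) \<le> 1"
    by (simp add: if_distrib[of cmod] if_distrib[of "\<lambda>t. t\<^sup>2"] cong: if_cong)
qed

section \<open>Operators\<close>

definition bounded_clinear :: "('a::complex_inner \<Rightarrow> 'b::complex_inner) \<Rightarrow> bool"
  where "bounded_clinear A \<longleftrightarrow> bounded_linear A \<and> (\<forall>c x. A (c *\<^sub>C x) = c *\<^sub>C A x)"

definition cadjoint :: "('a::chilbert_space \<Rightarrow> 'a) \<Rightarrow> 'a \<Rightarrow> 'a"
  where "cadjoint A = (THE B. \<forall>x y. cinner (A x) y = cinner x (B y))"

definition positive_op :: "('a::complex_inner \<Rightarrow> 'a) \<Rightarrow> bool"
  where "positive_op A \<longleftrightarrow> (\<forall>x. cinner (A x) x \<in> \<real>\<^sub>\<ge>\<^sub>0)"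

text \<open>\<open>cdim\<close>, like the library's \<open>dim\<close>, is 0 for infinite-dimensional spaces, so this is the
  rank only for operators of finite rank; it equals 1 exactly for the operators of rank one.\<close>

definition rank_op :: "('a::complex_vector \<Rightarrow> 'a) \<Rightarrow> nat"
  where "rank_op A = cdim (range A)"

definition closed_csubspace :: "'a::complex_inner set \<Rightarrow> bool"
  where "closed_csubspace M \<longleftrightarrow> csubspace M \<and> closed M"

definition proj :: "'a::complex_inner set \<Rightarrow> 'a \<Rightarrow> 'a"
  where "proj M x = (THE y. y \<in> M \<and> (\<forall>z\<in>M. cinner (x - y) z = 0))"

section \<open>Regular polyballs\<close>

text \<open>Tuples of operators are families \<open>T i s\<close> with \<open>i \<in> {1..k}\<close> and \<open>s \<in> {1..n i}\<close>; the entry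
  \<open>\<lambda>\<^bsub>i,j\<^esub>(s,t)\<close> is \<open>lam i j s t\<close>. Values at other indices are irrelevant.\<close>

definition Lambda_system :: "nat \<Rightarrow> (nat \<Rightarrow> nat) \<Rightarrow> (nat \<Rightarrow> nat \<Rightarrow> nat \<Rightarrow> nat \<Rightarrow> complex) \<Rightarrow> bool"
  where "Lambda_system k n lam \<longleftrightarrow>
    (\<forall>i\<in>{1..k}. \<forall>j\<in>{1..k}. i \<noteq> j \<longrightarrow> (\<forall>s\<in>{1..n i}. \<forall>t\<in>{1..n j}.
      cmod (lam i j s t) = 1 \<and> lam j i t s = cnj (lam i j s t)))"

definition Phi :: "(nat \<Rightarrow> nat) \<Rightarrow> real \<Rightarrow> (nat \<Rightarrow> nat \<Rightarrow> 'h \<Rightarrow> 'h) \<Rightarrow> nat \<Rightarrow>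
    ('h \<Rightarrow> 'h) \<Rightarrow> 'h \<Rightarrow> 'h::chilbert_space"
  where "Phi n r T i X = (\<lambda>x. \<Sum>s\<in>{1..n i}. r\<^sup>2 *\<^sub>R T i s (X (cadjoint (T i s) x)))"

definition Delta :: "nat \<Rightarrow> (nat \<Rightarrow> nat) \<Rightarrow> real \<Rightarrow> (nat \<Rightarrow> nat \<Rightarrow> 'h \<Rightarrow> 'h) \<Rightarrow>
    'h \<Rightarrow> 'h::chilbert_space"
  where "Delta k n r T = foldr (\<lambda>i X x. X x - Phi n r T i X x) [1..<Suc k] (\<lambda>x. x)"

definition regular_polyball :: "nat \<Rightarrow> (nat \<Rightarrow> nat) \<Rightarrow> (nat \<Rightarrow> nat \<Rightarrow> nat \<Rightarrow> nat \<Rightarrow> complex) \<Rightarrow>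
    (nat \<Rightarrow> nat \<Rightarrow> 'h::chilbert_space \<Rightarrow> 'h) set"
  where "regular_polyball k n lam = {T.
    (\<forall>i\<in>{1..k}. \<forall>s\<in>{1..n i}. bounded_clinear (T i s)) \<and>
    (\<forall>i\<in>{1..k}. positive_op (\<lambda>x. x - (\<Sum>s\<in>{1..n i}. T i s (cadjoint (T i s) x)))) \<and>
    (\<forall>i\<in>{1..k}. \<forall>j\<in>{1..k}. i \<noteq> j \<longrightarrow> (\<forall>s\<in>{1..n i}. \<forall>t\<in>{1..n j}.
      \<forall>x. T i s (T j t x) = lam i j s t *\<^sub>C T j t (T i s x))) \<and>
    (\<forall>r\<in>{0..<1}. positive_op (Delta k n r T))}"

definition pure_tuple :: "nat \<Rightarrow> (nat \<Rightarrow> nat) \<Rightarrow> (nat \<Rightarrow> nat \<Rightarrow> 'h::chilbert_space \<Rightarrow> 'h) \<Rightarrow> bool"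
  where "pure_tuple k n T \<longleftrightarrow>
    (\<forall>i\<in>{1..k}. \<forall>x. (\<lambda>q. (Phi n 1 T i ^^ q) (\<lambda>x. x) x) \<longlonglongrightarrow> 0)"

section \<open>The universal model\<close>

text \<open>Elements of the free semigroup on \<open>g\<^sub>1, \<dots>, g\<^bsub>n i\<^esub>\<close> are lists over \<open>{1..n i}\<close>, with
  concatenation as product and \<open>[]\<close> as neutral element.\<close>

definition words :: "nat \<Rightarrow> (nat \<Rightarrow> nat) \<Rightarrow> (nat \<Rightarrow> nat list) set"
  where "words k n = (\<Pi>\<^sub>E i\<in>{1..k}. lists {1..n i})"

text \<open>The Hilbert space of square-summable families on \<open>words k n\<close>, as the closed subspace of
  families on all of \<open>nat \<Rightarrow> nat list\<close> that vanish off \<open>words k n\<close>.\<close>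

definition fock :: "nat \<Rightarrow> (nat \<Rightarrow> nat) \<Rightarrow> (nat \<Rightarrow> nat list) ell2 set"
  where "fock k n = {f. \<forall>w. w \<notin> words k n \<longrightarrow> coord f w = 0}"

definition lam_word :: "(nat \<Rightarrow> nat \<Rightarrow> nat \<Rightarrow> nat \<Rightarrow> complex) \<Rightarrow> nat \<Rightarrow> nat \<Rightarrow> nat \<Rightarrow> nat list \<Rightarrow> complex"
  where "lam_word lam i j s u = (\<Prod>t\<leftarrow>u. lam i j s t)"

text \<open>The bounded operator with the prescribed values on the basis of \<open>fock k n\<close>, extended by 0 to
  the orthogonal complement. Since \<open>fock k n\<close> reduces this extension, adjoints and compressions
  to subspaces of \<open>fock k n\<close> agree with those formed inside \<open>fock k n\<close>.\<close>

definition std_shift :: "nat \<Rightarrow> (nat \<Rightarrow> nat) \<Rightarrow> (nat \<Rightarrow> nat \<Rightarrow> nat \<Rightarrow> nat \<Rightarrow> complex) \<Rightarrow>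
    nat \<Rightarrow> nat \<Rightarrow> (nat \<Rightarrow> nat list) ell2 \<Rightarrow> (nat \<Rightarrow> nat list) ell2"
  where "std_shift k n lam i s = (THE A. bounded_clinear A \<and>
    (\<forall>w\<in>words k n. A (chi w) = (\<Prod>j\<in>{1..<i}. lam_word lam i j s (w j)) *\<^sub>C chi (w(i := s # w i))) \<and>
    (\<forall>w. w \<notin> words k n \<longrightarrow> A (chi w) = 0))"

definition coinvariant :: "nat \<Rightarrow> (nat \<Rightarrow> nat) \<Rightarrow> (nat \<Rightarrow> nat \<Rightarrow> nat \<Rightarrow> nat \<Rightarrow> complex) \<Rightarrow>
    (nat \<Rightarrow> nat list) ell2 set \<Rightarrow> bool"
  where "coinvariant k n lam M \<longleftrightarrow> closed_csubspace M \<and> M \<subseteq> fock k n \<and>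
    (\<forall>i\<in>{1..k}. \<forall>s\<in>{1..n i}. cadjoint (std_shift k n lam i s) ` M \<subseteq> M)"

text \<open>Only the restriction of \<open>compression M A i s\<close> to \<open>M\<close> is meaningful.\<close>

definition compression :: "'a::complex_inner set \<Rightarrow> (nat \<Rightarrow> nat \<Rightarrow> 'a \<Rightarrow> 'a) \<Rightarrow> nat \<Rightarrow> nat \<Rightarrow> 'a \<Rightarrow> 'a"
  where "compression M A i s = (\<lambda>x. proj M (A i s x))"

definition unitary_onto :: "'a::complex_inner set \<Rightarrow> 'b::complex_inner set \<Rightarrow> ('a \<Rightarrow> 'b) \<Rightarrow> bool"
  where "unitary_onto V W U \<longleftrightarrow>
    (\<forall>x\<in>V. \<forall>y\<in>V. U (x + y) = U x + U y) \<and> (\<forall>c. \<forall>x\<in>V. U (c *\<^sub>C x) = c *\<^sub>C U x) \<and>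
    (\<forall>x\<in>V. \<forall>y\<in>V. cinner (U x) (U y) = cinner x y) \<and> U ` V = W"

text \<open>Joint unitary equivalence of the tuple \<open>A\<close> of operators on \<open>V\<close> with the tuple \<open>B\<close> of
  operators on \<open>W\<close>.\<close>

definition unitarily_equivalent :: "nat \<Rightarrow> (nat \<Rightarrow> nat) \<Rightarrow>
    'a::complex_inner set \<Rightarrow> (nat \<Rightarrow> nat \<Rightarrow> 'a \<Rightarrow> 'a) \<Rightarrow>
    'b::complex_inner set \<Rightarrow> (nat \<Rightarrow> nat \<Rightarrow> 'b \<Rightarrow> 'b) \<Rightarrow> bool"
  where "unitarily_equivalent k n V A W B \<longleftrightarrow> (\<exists>U. unitary_onto V W U \<and>
    (\<forall>i\<in>{1..k}. \<forall>s\<in>{1..n i}. \<forall>x\<in>V. U (A i s x) = B i s (U x)))"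

end

theory Submission
  imports Defs
begin

text \<open>
  If a pure \<open>T\<close> has a defect of rank one, positivity of the defect (let \<open>r\<close> tend to 1) gives a vector
  \<open>v\<close> with \<open>\<Delta>\<^sub>T(I)x = \<langle>x,v\<rangle>v\<close>. The embedding \<open>(K x)(\<alpha>) = \<langle>T\<^sub>\<alpha>\<^sup>* x, v\<rangle>\<close> then intertwines \<open>T\<^sup>*\<close> with
  \<open>S\<^sup>*\<close>, and it is isometric because summing \<open>T\<^sub>u (id - \<Phi>\<^sub>i)(X) T\<^sub>u\<^sup>*\<close> over all words \<open>u\<close> in the \<open>i\<close>-th
  letters telescopes to \<open>X\<close>, by purity; its range is the required co-invariant subspace.
  Conversely, a unitary onto a compression intertwines the adjoints of \<open>T\<close> with those of \<open>S\<close>, so that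
  all defects of \<open>T\<close> are restrictions of the diagonal defects of \<open>S\<close>.
  A unitary equivalence of two compressions preserves the rank-one form given by the vacuum
  coefficient, hence scales that coefficient by a unimodular constant; moving along words by the
  adjoint shifts, it is a multiple of the identity.
\<close>

section \<open>Complex Hilbert spaces\<close>

text \<open>Operator identities are read as identities of sesquilinear forms. In
  \<open>cinner (defect n r T (i # l) x) y\<close> every \<open>T i s\<close> moves to the other
  argument, and what remains is a recursion in the adjoints alone. The diagonal forms of the model
  obey the same recursion, so an isometry that intertwines the adjoints already transports every
  defect. Two obstacles shape the existence half. Regularity gives positivity of the full defect
  only, whereas telescoping passes through the partial defects; each of these inherits positivity
  because it is a sum of nonnegative values of the next larger one. Moreover, nested telescoping
  lets the adjoints of index 1 act last, while the phases of the model require them to act first.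
  Both orders therefore occur: the exact phase is tracked where the embedding meets the shifts, and
  only its modulus where norms are summed.\<close>

lemma cinner_add_right: "cinner x (y + z) = cinner x y + cinner x z"
  by (metis cinner_add_left cinner_commute complex_cnj_add)

lemma cinner_scaleC_right: "cinner x (c *\<^sub>C y) = cnj c * cinner x y"
  by (metis cinner_commute cinner_scaleC_left complex_cnj_mult)

lemma cinner_zero_left [simp]: "cinner 0 y = 0"
  using cinner_add_left[of 0 0 y] by simp

lemma cinner_zero_right [simp]: "cinner x 0 = 0"
  using cinner_add_right[of x 0 0] by simp

lemma cinner_diff_left: "cinner (x - y) z = cinner x z - cinner y z"
  using cinner_add_left[of "x - y" y z] by simp

lemma cinner_diff_right: "cinner x (y - z) = cinner x y - cinner x z"
  using cinner_add_right[of x "y - z" z] by simp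

lemma cinner_sum_left: "cinner (\<Sum>s\<in>I. f s) y = (\<Sum>s\<in>I. cinner (f s) y)"
  by (induction I rule: infinite_finite_induct) (simp_all add: cinner_add_left)

lemma cinner_scaleR_left: "cinner (r *\<^sub>R x) y = complex_of_real r * cinner x y"
  by (simp add: scaleR_scaleC cinner_scaleC_left)

lemma cinner_eqI: "x = y" if "\<And>z. cinner x z = cinner y z"
proof -
  have "cinner (x - y) (x - y) = 0" using that by (simp add: cinner_diff_left)
  then show ?thesis by (simp add: cinner_self)
qed

lemma cinner_eqI_right: "x = y" if "\<And>z. cinner z x = cinner z y"
  using that by (metis cinner_commute cinner_eqI)

text \<open>Pythagoras for removing the component along \<open>z\<close>. It yields Cauchy-Schwarz,
  and it shows that a closest point leaves an orthogonal remainder.\<close>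

lemma norm_sub_component:
  fixes x z :: "'a::complex_inner"
  assumes "z \<noteq> 0"
  shows "(norm (x - (cinner x z / (norm z)\<^sup>2) *\<^sub>C z))\<^sup>2 = (norm x)\<^sup>2 - (cmod (cinner x z))\<^sup>2 / (norm z)\<^sup>2"
    (is "(norm (x - ?c *\<^sub>C z))\<^sup>2 = ?R")
proof -
  have z: "complex_of_real ((norm z)\<^sup>2) \<noteq> 0" using assms by simp
  have zx: "cinner z x = cnj (cinner x z)" by (rule cinner_commute)
  have "complex_of_real ((norm (x - ?c *\<^sub>C z))\<^sup>2) = complex_of_real ?R"
    unfolding cinner_self[symmetric] cinner_diff_left cinner_diff_right cinner_scaleC_left cinner_scaleC_right zx
    unfolding cinner_self of_real_diff of_real_divide
    using z complex_norm_square[of "cinner x z"] by (simp add: field_simps)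
  then show ?thesis by (simp only: of_real_eq_iff)
qed

lemma cauchy_schwarz: "cmod (cinner x y) \<le> norm x * norm (y :: 'a::complex_inner)"
proof (cases "y = 0")
  case False
  have "0 \<le> (norm x)\<^sup>2 - (cmod (cinner x y))\<^sup>2 / (norm y)\<^sup>2"
    by (metis False norm_sub_component zero_le_power2)
  then have "(cmod (cinner x y))\<^sup>2 \<le> (norm x * norm y)\<^sup>2"
    using False by (simp add: field_simps)
  then show ?thesis by (rule power2_le_imp_le) simp
qed simp

lemma bounded_linear_cinner_left: "bounded_linear (\<lambda>x. cinner x y)"
  by (rule bounded_linear_intro[where K = "norm y"])
    (auto simp: cinner_add_left scaleR_scaleC cinner_scaleC_left scaleR_conv_of_real cauchy_schwarz)

lemma norm_diff_power2:
  fixes x y :: "'a::complex_inner"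
  shows "complex_of_real ((norm (x - y))\<^sup>2)
    = complex_of_real ((norm x)\<^sup>2) - cinner x y - cinner y x + complex_of_real ((norm y)\<^sup>2)"
  unfolding cinner_self[symmetric] by (simp add: cinner_diff_left cinner_diff_right)

lemma norm_add_power2:
  fixes x y :: "'a::complex_inner"
  shows "complex_of_real ((norm (x + y))\<^sup>2)
    = complex_of_real ((norm x)\<^sup>2) + cinner x y + cinner y x + complex_of_real ((norm y)\<^sup>2)"
  unfolding cinner_self[symmetric] by (simp add: cinner_add_left cinner_add_right)

lemma parallelogram:
  fixes x y :: "'a::complex_inner"
  shows "(norm (x + y))\<^sup>2 + (norm (x - y))\<^sup>2 = 2 * (norm x)\<^sup>2 + 2 * (norm y)\<^sup>2"
proof -
  have "complex_of_real ((norm (x + y))\<^sup>2 + (norm (x - y))\<^sup>2)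
      = complex_of_real (2 * (norm x)\<^sup>2 + 2 * (norm y)\<^sup>2)"
    unfolding of_real_add norm_add_power2 norm_diff_power2 by simp
  then show ?thesis by (simp only: of_real_eq_iff)
qed

lemma polarization:
  fixes x y :: "'a::complex_inner"
  shows "4 * cinner x y = complex_of_real ((norm (x + y))\<^sup>2) - complex_of_real ((norm (x - y))\<^sup>2)
    + \<i> * complex_of_real ((norm (x + \<i> *\<^sub>C y))\<^sup>2) - \<i> * complex_of_real ((norm (x - \<i> *\<^sub>C y))\<^sup>2)"
  unfolding norm_add_power2 norm_diff_power2
  by (simp add: cinner_scaleC_left cinner_scaleC_right algebra_simps)

lemma bounded_clinearD:
  assumes "bounded_clinear A"
  shows "bounded_linear A" "A (x + y) = A x + A y" "A (x - y) = A x - A y" "A (c *\<^sub>C x) = c *\<^sub>C A x"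
    "A (r *\<^sub>R x) = r *\<^sub>R A x" "A 0 = 0"
  using assms unfolding bounded_clinear_def
  by (auto simp: bounded_linear.linear linear_add linear_diff linear_scale linear_0)

lemma bounded_clinearI:
  assumes "\<And>x y. A (x + y) = A x + A y" "\<And>c x. A (c *\<^sub>C x) = c *\<^sub>C A x" "\<And>x. norm (A x) \<le> norm x * K"
  shows "bounded_clinear A"
  unfolding bounded_clinear_def
  using assms by (auto intro!: bounded_linear_intro[where K = K] simp: scaleR_scaleC)

text \<open>Telescoping computes only the norm of the embedding; polarization recovers the inner
  products.\<close>

lemma isometry_cinner:
  fixes A :: "'a::complex_inner \<Rightarrow> 'b::complex_inner"
  assumes add: "\<And>x y. A (x + y) = A x + A y" and scale: "\<And>c x. A (c *\<^sub>C x) = c *\<^sub>C A x"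
    and norm: "\<And>x. norm (A x) = norm x"
  shows "cinner (A x) (A y) = cinner x y"
proof -
  have diff: "A (x - y) = A x - A y" for x y
    using add[of "x - y" y] by simp
  have "4 * cinner (A x) (A y) = 4 * cinner x y"
    unfolding polarization add[symmetric] diff[symmetric] scale[symmetric] norm ..
  then show ?thesis by simp
qed

section \<open>Closed subspaces and orthogonal projections\<close>

lemma closed_csubspaceD:
  assumes "closed_csubspace M"
  shows "closed M" "0 \<in> M" "x \<in> M \<Longrightarrow> y \<in> M \<Longrightarrow> x + y \<in> M" "x \<in> M \<Longrightarrow> y \<in> M \<Longrightarrow> x - y \<in> M"
    "x \<in> M \<Longrightarrow> c *\<^sub>C x \<in> M" "x \<in> M \<Longrightarrow> r *\<^sub>R x \<in> M"
  using assms unfolding closed_csubspace_def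
  by (auto simp: scaleR_scaleC complex_vector.subspace_add complex_vector.subspace_diff
      complex_vector.subspace_scale complex_vector.subspace_0)

text \<open>A minimizing sequence for the distance to \<open>M\<close> is Cauchy by the parallelogram law.\<close>

lemma closest_point_exists:
  fixes M :: "'a::chilbert_space set"
  assumes M: "closed_csubspace M"
  shows "\<exists>y\<in>M. \<forall>z\<in>M. norm (x - y) \<le> norm (x - z)"
proof -
  note MD = closed_csubspaceD[OF M]
  define d where "d = (INF y\<in>M. norm (x - y))"
  have bdd: "bdd_below ((\<lambda>y. norm (x - y)) ` M)" by (auto intro!: bdd_belowI2[where m = 0])
  have d_le: "d \<le> norm (x - y)" if "y \<in> M" for y
    unfolding d_def using bdd that by (rule cINF_lower)
  have d0: "0 \<le> d" unfolding d_def using MD(2) by (intro cINF_greatest) auto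
  have "\<exists>y\<in>M. norm (x - y) < d + 1 / Suc m" for m
    using cINF_less_iff[OF _ bdd, of "d + 1 / Suc m"] MD(2) unfolding d_def by fastforce
  then obtain y where yM: "\<And>m. y m \<in> M" and y: "\<And>m. norm (x - y m) < d + 1 / Suc m" by metis
  have key: "(dist (y m) (y p))\<^sup>2 \<le> 4 * (2 * d + 1) / Suc N" if mp: "N \<le> m" "N \<le> p" for m p N
  proof -
    \<comment> \<open>The midpoint stays in \<open>M\<close>, which bounds the sum of the two
      difference vectors from below.\<close>
    have half: "norm (x - (1/2) *\<^sub>R (y m + y p)) \<ge> d"
      by (intro d_le MD(6) MD(3) yM)
    have "(x - y m) + (x - y p) = 2 *\<^sub>R (x - (1/2) *\<^sub>R (y m + y p))"
      by (simp add: scaleR_diff_right scaleR_2)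
    then have "norm ((x - y m) + (x - y p)) \<ge> 2 * d" using half by simp
    then have sq: "(norm ((x - y m) + (x - y p)))\<^sup>2 \<ge> (2 * d)\<^sup>2" using d0 by (intro power_mono) auto
    have le: "norm (x - y q) \<le> d + 1 / Suc N" if "N \<le> q" for q
    proof -
      have "norm (x - y q) \<le> d + 1 / Suc q" using y[of q] by simp
      also have "\<dots> \<le> d + 1 / Suc N" using that by (simp add: frac_le)
      finally show ?thesis .
    qed
    define e where "e = 1 / real (Suc N)"
    have e: "0 < e" "e \<le> 1" by (auto simp: e_def)
    have sq2: "(norm (x - y q))\<^sup>2 \<le> (d + e)\<^sup>2" if "N \<le> q" for q
      using le[OF that] by (auto intro!: power_mono simp: e_def)
    have "(dist (y m) (y p))\<^sup>2 = (norm ((x - y m) - (x - y p)))\<^sup>2"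
      by (simp add: dist_norm norm_minus_commute)
    also have "\<dots> \<le> 4 * (d + e)\<^sup>2 - (2 * d)\<^sup>2"
      using parallelogram[of "x - y m" "x - y p"] sq sq2[OF mp(1)] sq2[OF mp(2)] by linarith
    also have "\<dots> = 4 * (2 * d + e) * e" by (simp add: power2_eq_square algebra_simps)
    also have "\<dots> \<le> 4 * (2 * d + 1) * e" using e d0 by (intro mult_right_mono) auto
    finally show ?thesis by (simp add: e_def)
  qed
  have "Cauchy y"
  proof (rule metric_CauchyI)
    fix \<epsilon> :: real assume \<epsilon>: "0 < \<epsilon>"
    obtain N where "4 * (2 * d + 1) / \<epsilon>\<^sup>2 < real N" using reals_Archimedean2 by blast
    then have "4 * (2 * d + 1) < real N * \<epsilon>\<^sup>2" using \<epsilon> by (simp add: field_simps)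
    also have "\<dots> \<le> real (Suc N) * \<epsilon>\<^sup>2" by (intro mult_right_mono) auto
    finally have "4 * (2 * d + 1) / Suc N < \<epsilon>\<^sup>2" by (simp add: field_simps)
    then have "(dist (y m) (y p))\<^sup>2 < \<epsilon>\<^sup>2" if "N \<le> m" "N \<le> p" for m p
      using key[OF that] by linarith
    then show "\<exists>N. \<forall>m\<ge>N. \<forall>p\<ge>N. dist (y m) (y p) < \<epsilon>"
      using \<epsilon> by (meson less_imp_le power2_less_imp_less)
  qed
  then obtain l where l: "y \<longlonglongrightarrow> l" using convergent_eq_Cauchy by blast
  have "l \<in> M" using closed_sequentially[OF MD(1) yM l] .
  have "norm (x - l) \<le> d"
  proof (rule LIMSEQ_le)
    show "(\<lambda>m. norm (x - y m)) \<longlonglongrightarrow> norm (x - l)" by (intro tendsto_intros l)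
    show "(\<lambda>m. d + 1 / Suc m) \<longlonglongrightarrow> d"
      using tendsto_add[OF tendsto_const[of d] LIMSEQ_inverse_real_of_nat] by (simp add: inverse_eq_divide)
    show "\<exists>N. \<forall>m\<ge>N. norm (x - y m) \<le> d + 1 / Suc m" using y less_imp_le by blast
  qed
  then show ?thesis using d_le \<open>l \<in> M\<close> by (meson order_trans)
qed

lemma proj_props:
  fixes M :: "'a::chilbert_space set"
  assumes M: "closed_csubspace M"
  shows "proj M x \<in> M" "z \<in> M \<Longrightarrow> cinner (x - proj M x) z = 0"
proof -
  note MD = closed_csubspaceD[OF M]
  obtain y where y: "y \<in> M" and min: "\<And>z. z \<in> M \<Longrightarrow> norm (x - y) \<le> norm (x - z)"
    using closest_point_exists[OF M] by metis
  have orth: "cinner (x - y) z = 0" if "z \<in> M" for z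
  proof (cases "z = 0")
    case False
    \<comment> \<open>The coefficient of \<open>x - y\<close> along \<open>z\<close>: moving
      \<open>y\<close> by it would shorten the distance unless the coefficient vanishes.\<close>
    let ?c = "cinner (x - y) z / (norm z)\<^sup>2"
    have "norm (x - y) \<le> norm (x - (y + ?c *\<^sub>C z))" by (intro min MD y that)
    also have "x - (y + ?c *\<^sub>C z) = x - y - ?c *\<^sub>C z" by simp
    finally have "(norm (x - y))\<^sup>2 \<le> (norm (x - y - ?c *\<^sub>C z))\<^sup>2" by (intro power_mono) auto
    also have "\<dots> = (norm (x - y))\<^sup>2 - (cmod (cinner (x - y) z))\<^sup>2 / (norm z)\<^sup>2"
      by (rule norm_sub_component[OF False])
    finally have "(cmod (cinner (x - y) z))\<^sup>2 / (norm z)\<^sup>2 \<le> 0" by linarith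
    then show ?thesis using False by (simp add: divide_le_0_iff)
  qed simp
  have "proj M x \<in> M \<and> (\<forall>z\<in>M. cinner (x - proj M x) z = 0)"
    unfolding proj_def
  proof (rule theI2[where a = y])
    show "y \<in> M \<and> (\<forall>z\<in>M. cinner (x - y) z = 0)" using y orth by blast
    fix y' assume y': "y' \<in> M \<and> (\<forall>z\<in>M. cinner (x - y') z = 0)"
    have "cinner (y' - y) (y' - y) = cinner (x - y) (y' - y) - cinner (x - y') (y' - y)"
      by (simp add: cinner_diff_left)
    also have "\<dots> = 0" using y y' orth MD(4) by simp
    finally show "y' = y" by (simp add: cinner_self)
  qed
  then show "proj M x \<in> M" "z \<in> M \<Longrightarrow> cinner (x - proj M x) z = 0" by auto
qed

lemma cinner_proj_left:
  "closed_csubspace M \<Longrightarrow> z \<in> M \<Longrightarrow> cinner (proj M x) z = cinner (x :: 'a::chilbert_space) z"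
  using proj_props(2)[of M z x] by (simp add: cinner_diff_left)

lemma cinner_proj_right:
  "closed_csubspace M \<Longrightarrow> z \<in> M \<Longrightarrow> cinner z (proj M x) = cinner z (x :: 'a::chilbert_space)"
  by (metis cinner_proj_left cinner_commute)

section \<open>Riesz representation and adjoints\<close>

lemma riesz_representation:
  fixes f :: "'a::chilbert_space \<Rightarrow> complex"
  assumes f: "bounded_linear f" and scale: "\<And>c x. f (c *\<^sub>C x) = c * f x"
  shows "\<exists>y. \<forall>x. f x = cinner x y"
proof (cases "\<forall>x. f x = 0")
  case True
  then show ?thesis by (intro exI[of _ 0]) simp
next
  case False
  then obtain x0 where x0: "f x0 \<noteq> 0" by blast
  interpret f: bounded_linear f by (rule f)
  define N where "N = {x. f x = 0}"
  have "closed N" unfolding N_def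
    by (intro closed_Collect_eq continuous_intros f.continuous_on)
  moreover have "csubspace N"
    by (auto intro!: complex_vector.subspaceI simp: N_def f.zero f.add scale)
  ultimately have N: "closed_csubspace N" by (simp add: closed_csubspace_def)
  define z where "z = x0 - proj N x0"
  have fz: "f z = f x0" using proj_props(1)[OF N, of x0] by (simp add: z_def N_def f.diff)
  then have z0: "z \<noteq> 0" using x0 f.zero by auto
  have orth: "cinner x z = 0" if "f x = 0" for x
    using proj_props(2)[OF N, of x x0] that cinner_commute[of x z] by (simp add: N_def z_def)
  have "f x = cinner x (cnj (f z / (norm z)\<^sup>2) *\<^sub>C z)" for x
  proof -
    \<comment> \<open>This combination lies in the kernel, hence is orthogonal to \<open>z\<close>,
      and the resulting equation can be solved for \<open>f x\<close>.\<close>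
    have "f (f z *\<^sub>C x - f x *\<^sub>C z) = 0" by (simp add: f.diff scale)
    then have "cinner (f z *\<^sub>C x - f x *\<^sub>C z) z = 0" by (rule orth)
    then have "f z * cinner x z = f x * complex_of_real ((norm z)\<^sup>2)"
      by (simp add: cinner_diff_left cinner_scaleC_left cinner_self)
    then show ?thesis using z0 by (simp add: cinner_scaleC_right field_simps)
  qed
  then show ?thesis by blast
qed

lemma cadjoint_eqI:
  assumes "\<And>x y. cinner (A x) y = cinner x (B y)"
  shows "cadjoint A = B"
  unfolding cadjoint_def
proof (rule the_equality)
  fix B' assume "\<forall>x y. cinner (A x) y = cinner x (B' y)"
  then show "B' = B" using assms by (intro ext cinner_eqI_right) metis
qed (use assms in blast)

lemma cinner_cadjoint:
  fixes A :: "'a::chilbert_space \<Rightarrow> 'a"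
  assumes A: "bounded_clinear A"
  shows "cinner (A x) y = cinner x (cadjoint A y)"
proof -
  have "\<exists>z. \<forall>x. cinner (A x) y = cinner x z" for y
    using bounded_clinearD[OF A]
    by (intro riesz_representation bounded_linear_compose[OF bounded_linear_cinner_left])
      (auto simp: cinner_scaleC_left)
  then obtain B where B: "\<And>x y. cinner (A x) y = cinner x (B y)" by metis
  show ?thesis using cadjoint_eqI[of A B, OF B] B by simp
qed

lemma cinner_cadjoint':
  fixes A :: "'a::chilbert_space \<Rightarrow> 'a"
  assumes "bounded_clinear A"
  shows "cinner y (A x) = cinner (cadjoint A y) x"
  by (metis cinner_cadjoint[OF assms] cinner_commute)

lemma bounded_clinear_cadjoint:
  fixes A :: "'a::chilbert_space \<Rightarrow> 'a"
  assumes A: "bounded_clinear A"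
  shows "bounded_clinear (cadjoint A)"
proof -
  note AD = bounded_clinearD[OF A]
  obtain K where K: "\<And>x. norm (A x) \<le> norm x * K" "0 \<le> K"
    using bounded_linear.nonneg_bounded[OF AD(1)] by auto
  show ?thesis
  proof (rule bounded_clinearI[where K = K])
    show "cadjoint A (x + y) = cadjoint A x + cadjoint A y" for x y
      by (rule cinner_eqI_right) (simp add: cinner_add_right flip: cinner_cadjoint[OF A])
    show "cadjoint A (c *\<^sub>C x) = c *\<^sub>C cadjoint A x" for c x
      by (rule cinner_eqI_right) (simp add: cinner_scaleC_right flip: cinner_cadjoint[OF A])
    show "norm (cadjoint A x) \<le> norm x * K" for x
    proof (cases "cadjoint A x = 0")
      case False
      have "(norm (cadjoint A x))\<^sup>2 = cmod (cinner (cadjoint A x) (cadjoint A x))"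
        unfolding cinner_self by (simp only: norm_of_real abs_power2)
      also have "\<dots> = cmod (cinner (A (cadjoint A x)) x)" by (simp add: cinner_cadjoint[OF A])
      also have "\<dots> \<le> norm (A (cadjoint A x)) * norm x" by (rule cauchy_schwarz)
      also have "\<dots> \<le> norm (cadjoint A x) * K * norm x" by (intro mult_right_mono K) simp
      finally show ?thesis using False by (simp add: power2_eq_square mult.assoc mult.commute[of K])
    qed (simp add: K)
  qed
qed

section \<open>Square-summable families and the model shifts\<close>

lemma ell2_eqI: "f = g" if "\<And>w. coord f w = coord g w"
  using that by (intro coord_inject[THEN iffD1]) auto

lemma cinner_chi: "cinner f (chi a) = coord f a"
proof -
  have "cinner f (chi a) = (\<Sum>\<^sub>\<infinity>x\<in>{a}. coord f x)"
    unfolding cinner_ell2.rep_eq by (rule infsum_cong_neutral) (auto simp: chi.rep_eq)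
  then show ?thesis by simp
qed

lemma coord_prod_summable: "(\<lambda>x. coord f x * cnj (coord g x)) summable_on A"
  using coord[of f] coord[of g] by (intro summable_on_subset_banach[OF sq_summable_product]) auto

text \<open>This replaces a density argument: the coordinates of \<open>cadjoint A f\<close> are the
  inner products of \<open>f\<close> with the vectors \<open>A (chi w)\<close>, so the adjoints
  agree first and then the operators.\<close>

lemma bounded_clinear_eqI_chi:
  fixes A B :: "'a ell2 \<Rightarrow> 'a ell2"
  assumes A: "bounded_clinear A" and B: "bounded_clinear B" and eq: "\<And>w. A (chi w) = B (chi w)"
  shows "A = B"
proof -
  have "cadjoint A f = cadjoint B f" for f
    by (rule ell2_eqI) (simp flip: cinner_chi cinner_cadjoint'[OF A] cinner_cadjoint'[OF B] add: eq)
  then show ?thesis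
    by (intro ext cinner_eqI) (simp add: cinner_cadjoint[OF A] cinner_cadjoint[OF B])
qed

text \<open>The weighted shift is obtained as the adjoint of the weighted composition operator, whose
  boundedness is immediate.\<close>

lemma weighted_shift_exists:
  fixes \<phi> :: "'a \<Rightarrow> 'a" and c :: "'a \<Rightarrow> complex"
  assumes inj: "inj_on \<phi> D" and c: "\<And>x. x \<in> D \<Longrightarrow> cmod (c x) = 1"
  shows "\<exists>A. bounded_clinear A \<and> (\<forall>x\<in>D. A (chi x) = c x *\<^sub>C chi (\<phi> x)) \<and> (\<forall>x. x \<notin> D \<longrightarrow> A (chi x) = 0)
    \<and> (\<forall>f x. coord (cadjoint A f) x = (if x \<in> D then cnj (c x) * coord f (\<phi> x) else 0))"
proof -
  define b where "b f x = (if x \<in> D then cnj (c x) * coord f (\<phi> x) else 0)" for f x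
  have b_bound: "(\<Sum>x\<in>F. (cmod (b f x))\<^sup>2) \<le> (norm f)\<^sup>2" if F: "finite F" for F f
  proof -
    have "(\<Sum>x\<in>F. (cmod (b f x))\<^sup>2) = (\<Sum>x\<in>F \<inter> D. (cmod (coord f (\<phi> x)))\<^sup>2)"
      using F by (intro sum.mono_neutral_cong_right) (auto simp: b_def norm_mult c)
    also have "\<dots> = (\<Sum>x\<in>\<phi> ` (F \<inter> D). (cmod (coord f x))\<^sup>2)"
      using inj by (subst sum.reindex) (auto intro: inj_on_subset)
    also have "\<dots> \<le> (norm f)\<^sup>2"
      unfolding norm_ell2_power2 using coord[of f] F by (intro finite_sum_le_infsum) auto
    finally show ?thesis .
  qed
  have b_sum: "(\<lambda>x. (cmod (b f x))\<^sup>2) summable_on UNIV" for f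
    using b_bound by (rule sq_summableI)
  define B where "B f = Abs_ell2 (b f)" for f
  have coord_B: "coord (B f) = b f" for f
    unfolding B_def using b_sum by (simp add: Abs_ell2_inverse)
  have B: "bounded_clinear B"
  proof (rule bounded_clinearI[where K = 1])
    show "B (f + g) = B f + B g" for f g
      by (rule ell2_eqI) (simp add: coord_B b_def plus_ell2.rep_eq distrib_left)
    show "B (a *\<^sub>C f) = a *\<^sub>C B f" for a f
      by (rule ell2_eqI) (simp add: coord_B b_def scaleC_ell2.rep_eq)
    show "norm (B f) \<le> norm f * 1" for f
    proof -
      have "norm (B f) \<le> norm f"
        by (rule norm_ell2_leI) (simp add: L2_set_def coord_B real_le_lsqrt b_bound sum_nonneg)
      then show ?thesis by simp
    qed
  qed
  define A where "A = cadjoint B"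
  have A: "bounded_clinear A" unfolding A_def by (rule bounded_clinear_cadjoint[OF B])
  have "cadjoint A = B"
    by (rule cadjoint_eqI) (simp add: A_def cinner_cadjoint'[OF B])
  moreover have "coord (A (chi x)) y = (if x \<in> D then c x * coord (chi (\<phi> x)) y else 0)" for x y
  proof -
    have "coord (A (chi x)) y = cinner (chi x) (B (chi y))"
      by (simp add: cinner_cadjoint'[OF B] A_def flip: cinner_chi)
    also have "\<dots> = cnj (coord (B (chi y)) x)" by (metis cinner_chi cinner_commute)
    finally show ?thesis by (auto simp: coord_B b_def chi.rep_eq)
  qed
  then have "A (chi x) = (if x \<in> D then c x *\<^sub>C chi (\<phi> x) else 0)" for x
    by (intro ell2_eqI) (auto simp: scaleC_ell2.rep_eq zero_ell2.rep_eq)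
  ultimately show ?thesis using A by (intro exI[of _ A]) (auto simp: coord_B b_def)
qed

section \<open>Words and the coordinates of the adjoint shifts\<close>

lemma words_upd:
  assumes "w \<in> words k n" "i \<in> {1..k}" "u \<in> lists {1..n i}"
  shows "w(i := u) \<in> words k n"
  using assms unfolding words_def by (auto simp: PiE_iff extensional_def)

lemma words_entry: "w \<in> words k n \<Longrightarrow> i \<in> {1..k} \<Longrightarrow> w i \<in> lists {1..n i}"
  unfolding words_def by auto

definition shift_phase :: "(nat \<Rightarrow> nat \<Rightarrow> nat \<Rightarrow> nat \<Rightarrow> complex) \<Rightarrow> nat \<Rightarrow> nat \<Rightarrow> (nat \<Rightarrow> nat list) \<Rightarrow> complex"
  where "shift_phase lam i s w = (\<Prod>j\<in>{1..<i}. lam_word lam i j s (w j))"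

lemma cmod_lam_word:
  assumes "Lambda_system k n lam" "i \<in> {1..k}" "j \<in> {1..k}" "i \<noteq> j" "s \<in> {1..n i}" "u \<in> lists {1..n j}"
  shows "cmod (lam_word lam i j s u) = 1"
proof -
  have "cmod (lam i j s t) = 1" if "t \<in> {1..n j}" for t
    using assms(1-5) that unfolding Lambda_system_def by blast
  then show ?thesis
    using assms(6) unfolding lam_word_def by (induction u) (auto simp: norm_mult)
qed

lemma cmod_shift_phase:
  assumes L: "Lambda_system k n lam" and i: "i \<in> {1..k}" and s: "s \<in> {1..n i}" and w: "w \<in> words k n"
  shows "cmod (shift_phase lam i s w) = 1"
  unfolding shift_phase_def prod_norm[symmetric]
  using i by (intro prod.neutral ballI cmod_lam_word[OF L i _ _ s] words_entry[OF w]) auto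

lemma inj_prepend: "inj_on (\<lambda>w :: nat \<Rightarrow> nat list. w(i := s # w i)) A"
proof (rule inj_onI)
  fix v w :: "nat \<Rightarrow> nat list"
  assume "v(i := s # v i) = w(i := s # w i)"
  then have "(v(i := s # v i)) j = (w(i := s # w i)) j" for j by simp
  then have "v j = w j" for j by (cases "j = i") (metis fun_upd_same list.inject, metis fun_upd_other)
  then show "v = w" by blast
qed

text \<open>Values on the whole basis, including 0 off \<open>words k n\<close>, determine a bounded
  operator, which resolves the description in \<open>std_shift\<close>. From here on the model is
  used through its boundedness and the coordinates of its adjoints.\<close>

lemma
  assumes L: "Lambda_system k n lam" and i: "i \<in> {1..k}" and s: "s \<in> {1..n i}"
  shows bounded_clinear_std_shift: "bounded_clinear (std_shift k n lam i s)"
    and coord_cadjoint_std_shift: "coord (cadjoint (std_shift k n lam i s) f) w =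
      (if w \<in> words k n then cnj (shift_phase lam i s w) * coord f (w(i := s # w i)) else 0)"
proof -
  obtain A where A: "bounded_clinear A"
      "\<forall>w\<in>words k n. A (chi w) = shift_phase lam i s w *\<^sub>C chi (w(i := s # w i))"
      "\<forall>w. w \<notin> words k n \<longrightarrow> A (chi w) = 0"
    and adj: "\<forall>f w. coord (cadjoint A f) w =
      (if w \<in> words k n then cnj (shift_phase lam i s w) * coord f (w(i := s # w i)) else 0)"
    using weighted_shift_exists[OF inj_prepend[of i s "words k n"], where c = "shift_phase lam i s"]
      cmod_shift_phase[OF L i s] by blast
  have "std_shift k n lam i s = A"
    unfolding std_shift_def shift_phase_def[symmetric]
  proof (rule the_equality)
    fix B assume "bounded_clinear B \<and>
      (\<forall>w\<in>words k n. B (chi w) = shift_phase lam i s w *\<^sub>C chi (w(i := s # w i))) \<and>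
      (\<forall>w. w \<notin> words k n \<longrightarrow> B (chi w) = 0)"
    then show "B = A" using A by (intro bounded_clinear_eqI_chi) (blast, blast, metis)
  qed (use A in blast)
  then show "bounded_clinear (std_shift k n lam i s)"
    and "coord (cadjoint (std_shift k n lam i s) f) w =
      (if w \<in> words k n then cnj (shift_phase lam i s w) * coord f (w(i := s # w i)) else 0)"
    using A adj by auto
qed

text \<open>A coordinate at a longer word is, up to a phase, a coordinate at a shorter word of
  another vector. In a family of vectors stable under the adjoint shifts this carries statements
  from the empty words to all words.\<close>

lemma coord_upd_eq:
  assumes L: "Lambda_system k n lam" and i: "i \<in> {1..k}" and s: "s \<in> {1..n i}" and w: "w \<in> words k n"
  shows "coord f (w(i := s # w i)) = shift_phase lam i s w * coord (cadjoint (std_shift k n lam i s) f) w"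
proof -
  have "shift_phase lam i s w * cnj (shift_phase lam i s w) = 1"
    using cmod_shift_phase[OF L i s w] complex_norm_square[of "shift_phase lam i s w"] by simp
  then show ?thesis using w by (simp add: coord_cadjoint_std_shift[OF L i s] flip: mult.assoc)
qed

section \<open>Diagonal forms on the Fock space\<close>

text \<open>The form of the diagonal operator with entries \<open>d\<close>. For bounded
  \<open>d\<close> the sums converge absolutely, so the form can be used without constructing the
  operator.\<close>

definition diag_form :: "nat \<Rightarrow> (nat \<Rightarrow> nat) \<Rightarrow> ((nat \<Rightarrow> nat list) \<Rightarrow> real) \<Rightarrow>
    (nat \<Rightarrow> nat list) ell2 \<Rightarrow> (nat \<Rightarrow> nat list) ell2 \<Rightarrow> complex"
  where "diag_form k n d f g = (\<Sum>\<^sub>\<infinity>w\<in>words k n. complex_of_real (d w) * (coord f w * cnj (coord g w)))"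

lemma summable_on_mult_bounded:
  fixes e :: "'a \<Rightarrow> complex" and d :: "'a \<Rightarrow> real"
  assumes e: "e summable_on A" and d: "\<And>w. \<bar>d w\<bar> \<le> B"
  shows "(\<lambda>w. complex_of_real (d w) * e w) summable_on A"
proof (rule abs_summable_summable, rule Infinite_Sum.abs_summable_on_comparison_test')
  have "(\<lambda>w. cmod (e w)) summable_on A"
    using e by (simp add: summable_on_iff_abs_summable_on_complex[of e])
  then show "(\<lambda>w. B * cmod (e w)) summable_on A" by (rule summable_on_cmult_right)
  show "cmod (complex_of_real (d w) * e w) \<le> B * cmod (e w)" for w
    using d[of w] by (auto simp: norm_mult intro!: mult_right_mono)
qed

lemma diag_form_summable:
  "(\<And>w. \<bar>d w\<bar> \<le> B) \<Longrightarrow> (\<lambda>w. complex_of_real (d w) * (coord f w * cnj (coord g w))) summable_on A"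
  by (intro summable_on_mult_bounded[where B = B] coord_prod_summable)

lemma diag_form_diff:
  assumes d: "\<And>w. \<bar>d w\<bar> \<le> B" and e: "\<And>w. \<bar>e w\<bar> \<le> C"
  shows "diag_form k n (\<lambda>w. d w - c * e w) f g = diag_form k n d f g - of_real c * diag_form k n e f g"
proof -
  note s = diag_form_summable[of d, OF d] summable_on_cmult_right[OF diag_form_summable[of e, OF e], of "of_real c"]
  have "diag_form k n (\<lambda>w. d w - c * e w) f g = (\<Sum>\<^sub>\<infinity>w\<in>words k n. complex_of_real (d w) * (coord f w * cnj (coord g w))
      + - (of_real c * (complex_of_real (e w) * (coord f w * cnj (coord g w)))))"
    unfolding diag_form_def by (intro infsum_cong) (simp add: algebra_simps)
  also have "\<dots> = diag_form k n d f g - of_real c * diag_form k n e f g"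
    unfolding diag_form_def infsum_add[OF s(1) summable_on_uminus[THEN iffD2, OF s(2)]]
    by (simp add: infsum_uminus infsum_cmult_right')
  finally show ?thesis .
qed

lemma diag_form_self:
  "diag_form k n d f f = complex_of_real (\<Sum>\<^sub>\<infinity>w\<in>words k n. d w * (cmod (coord f w))\<^sup>2)"
  if d: "\<And>w. \<bar>d w\<bar> \<le> B"
proof -
  have eq: "complex_of_real (d w) * (coord f w * cnj (coord f w)) = complex_of_real (d w * (cmod (coord f w))\<^sup>2)" for w
    using complex_norm_square[of "coord f w"] by simp
  have "(\<lambda>w. complex_of_real (d w * (cmod (coord f w))\<^sup>2)) summable_on words k n"
    using diag_form_summable[of d B f f "words k n", OF d] unfolding eq .
  then have "(\<lambda>w. d w * (cmod (coord f w))\<^sup>2) summable_on words k n"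
    using summable_on_Re by fastforce
  then show ?thesis
    unfolding diag_form_def eq by (intro infsumI has_sum_of_real has_sum_infsum)
qed

lemma diag_form_nonneg:
  assumes d: "\<And>w. \<bar>d w\<bar> \<le> B" and pos: "\<And>w. 0 \<le> d w"
  shows "diag_form k n d f f \<in> \<real>\<^sub>\<ge>\<^sub>0"
  unfolding diag_form_self[OF d] by (auto intro!: infsum_nonneg mult_nonneg_nonneg pos)

lemma diag_form_one: "f \<in> fock k n \<Longrightarrow> diag_form k n (\<lambda>_. 1) f g = cinner f g"
  unfolding diag_form_def cinner_ell2.rep_eq fock_def by (rule infsum_cong_neutral) auto

text \<open>Summing over the first letter of the \<open>i\<close>-th word; the unimodular phases of the shifts cancel.\<close>

lemma diag_form_shift:
  assumes L: "Lambda_system k n lam" and i: "i \<in> {1..k}" and d: "\<And>w. \<bar>d w\<bar> \<le> B"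
  shows "(\<Sum>s\<in>{1..n i}. diag_form k n d (cadjoint (std_shift k n lam i s) f) (cadjoint (std_shift k n lam i s) g))
    = diag_form k n (\<lambda>w. if w i = [] then 0 else d (w(i := tl (w i)))) f g"
proof -
  define e where "e w = complex_of_real (d (w(i := tl (w i)))) * (coord f w * cnj (coord g w))" for w
  define \<phi> where "\<phi> s w = w(i := s # w i)" for s :: nat and w :: "nat \<Rightarrow> nat list"
  have e_sum: "e summable_on A" for A
    unfolding e_def by (intro summable_on_mult_bounded[where B = B] coord_prod_summable d)
  have "diag_form k n d (cadjoint (std_shift k n lam i s) f) (cadjoint (std_shift k n lam i s) g)
      = infsum e (\<phi> s ` words k n)" if s: "s \<in> {1..n i}" for s
  proof -
    have "diag_form k n d (cadjoint (std_shift k n lam i s) f) (cadjoint (std_shift k n lam i s) g)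
        = (\<Sum>\<^sub>\<infinity>w\<in>words k n. (e \<circ> \<phi> s) w)"
      unfolding diag_form_def
    proof (rule infsum_cong)
      fix w assume w: "w \<in> words k n"
      have "cnj (shift_phase lam i s w) * shift_phase lam i s w = 1"
        using cmod_shift_phase[OF L i s w] complex_norm_square[of "shift_phase lam i s w"]
        by (simp add: mult.commute)
      then have "cnj (shift_phase lam i s w) * a * cnj (cnj (shift_phase lam i s w) * b) = a * cnj b" for a b
        by (metis (no_types, lifting) complex_cnj_cnj complex_cnj_mult mult.assoc mult.commute mult_1)
      then show "complex_of_real (d w) * (coord (cadjoint (std_shift k n lam i s) f) w *
          cnj (coord (cadjoint (std_shift k n lam i s) g) w)) = (e \<circ> \<phi> s) w"
        using w by (simp add: coord_cadjoint_std_shift[OF L i s] e_def \<phi>_def)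
    qed
    also have "\<dots> = infsum e (\<phi> s ` words k n)"
      unfolding \<phi>_def by (intro infsum_reindex[symmetric] inj_prepend)
    finally show ?thesis .
  qed
  then have "(\<Sum>s\<in>{1..n i}. diag_form k n d (cadjoint (std_shift k n lam i s) f) (cadjoint (std_shift k n lam i s) g))
      = (\<Sum>s\<in>{1..n i}. infsum e (\<phi> s ` words k n))" by simp
  also have "\<dots> = infsum e (\<Union>s\<in>{1..n i}. \<phi> s ` words k n)"
  proof (rule sum_infsum)
    fix s t :: nat assume st: "s \<noteq> t"
    have "\<phi> s v \<noteq> \<phi> t w" for v w
    proof
      assume "\<phi> s v = \<phi> t w"
      then have "\<phi> s v i = \<phi> t w i" by simp
      then show False using st by (simp add: \<phi>_def)
    qed
    then show "\<phi> s ` words k n \<inter> \<phi> t ` words k n = {}" by auto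
  qed (use e_sum in auto)
  also have "(\<Union>s\<in>{1..n i}. \<phi> s ` words k n) = {w \<in> words k n. w i \<noteq> []}"
  proof (intro set_eqI iffI)
    fix w assume "w \<in> (\<Union>s\<in>{1..n i}. \<phi> s ` words k n)"
    then show "w \<in> {w \<in> words k n. w i \<noteq> []}"
      using words_upd[OF _ i] words_entry[OF _ i] by (auto simp: \<phi>_def)
  next
    fix w assume w: "w \<in> {w \<in> words k n. w i \<noteq> []}"
    then obtain s u where su: "w i = s # u" by (auto simp: neq_Nil_conv)
    then have "s # u \<in> lists {1..n i}" using w words_entry[of w k n i, OF _ i] by auto
    then have "s \<in> {1..n i}" "w(i := u) \<in> words k n" using words_upd[OF _ i, of w n u] w by auto
    moreover have "w = \<phi> s (w(i := u))" using su by (auto simp: \<phi>_def)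
    ultimately show "w \<in> (\<Union>s\<in>{1..n i}. \<phi> s ` words k n)" by blast
  qed
  also have "infsum e \<dots> = diag_form k n (\<lambda>w. if w i = [] then 0 else d (w(i := tl (w i)))) f g"
    unfolding diag_form_def by (rule infsum_cong_neutral) (auto simp: e_def)
  finally show ?thesis .
qed

text \<open>The diagonal of the defect operator of the model over the indices in \<open>l\<close>.\<close>

definition defect_weight :: "real \<Rightarrow> nat list \<Rightarrow> (nat \<Rightarrow> nat list) \<Rightarrow> real"
  where "defect_weight r l w = (\<Prod>i\<leftarrow>l. if w i = [] then 1 else 1 - r\<^sup>2)"

lemma defect_weight_bounds:
  assumes "0 \<le> r" "r \<le> 1"
  shows "0 \<le> defect_weight r l w" "\<bar>defect_weight r l w\<bar> \<le> 1"
proof -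
  have r: "r\<^sup>2 \<le> 1" using assms by (simp add: power_le_one)
  have "0 \<le> defect_weight r l w \<and> defect_weight r l w \<le> 1"
    unfolding defect_weight_def by (induction l) (use r in \<open>auto intro: mult_le_one\<close>)
  then show "0 \<le> defect_weight r l w" "\<bar>defect_weight r l w\<bar> \<le> 1" by auto
qed

lemma defect_weight_upd: "i \<notin> set l \<Longrightarrow> defect_weight r l (w(i := u)) = defect_weight r l w"
  unfolding defect_weight_def by (intro arg_cong[where f = prod_list] map_cong) auto

text \<open>The same recursion as in \<open>cinner_defect_Cons\<close>. That \<open>i\<close> is not
  in \<open>l\<close> matters: deleting a letter of the \<open>i\<close>-th word must leave the
  weight over \<open>l\<close> unchanged.\<close>

lemma diag_form_defect_Cons:
  assumes L: "Lambda_system k n lam" and i: "i \<in> {1..k}" "i \<notin> set l" and r: "0 \<le> r" "r \<le> 1"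
  shows "diag_form k n (defect_weight r (i # l)) f g = diag_form k n (defect_weight r l) f g -
    of_real (r\<^sup>2) * (\<Sum>s\<in>{1..n i}. diag_form k n (defect_weight r l)
      (cadjoint (std_shift k n lam i s) f) (cadjoint (std_shift k n lam i s) g))"
proof -
  note b = defect_weight_bounds[OF r]
  let ?e = "\<lambda>w. if w i = [] then 0 else defect_weight r l (w(i := tl (w i)))"
  have e: "\<bar>?e w\<bar> \<le> 1" for w using b by simp
  have "defect_weight r (i # l) = (\<lambda>w. defect_weight r l w - r\<^sup>2 * ?e w)"
    by (rule ext) (simp add: defect_weight_upd[OF i(2)], simp add: defect_weight_def algebra_simps)
  then show ?thesis
    using diag_form_diff[OF b(2) e] by (simp only: diag_form_shift[OF L i(1) b(2)])
qed

section \<open>The vacuum and induction along words\<close>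

definition empty_words :: "nat \<Rightarrow> nat \<Rightarrow> nat list"
  where "empty_words k = (\<lambda>i\<in>{1..k}. [])"

lemma empty_words_in: "empty_words k \<in> words k n"
  unfolding empty_words_def words_def by auto

text \<open>At \<open>r = 1\<close> a nonempty entry contributes the factor 1 - 1 = 0, so the weight
  is the indicator of the empty tuple: the defect of the model is the projection onto the
  vacuum.\<close>

lemma diag_form_defect_one:
  "diag_form k n (defect_weight 1 [1..<Suc k]) f g = coord f (empty_words k) * cnj (coord g (empty_words k))"
proof -
  have "diag_form k n (defect_weight 1 [1..<Suc k]) f g
      = (\<Sum>\<^sub>\<infinity>w\<in>{empty_words k}. coord f w * cnj (coord g w))"
    unfolding diag_form_def
  proof (rule infsum_cong_neutral)
    fix w assume w: "w \<in> words k n - {empty_words k}"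
    have "\<exists>i\<in>{1..k}. w i \<noteq> []"
    proof (rule ccontr)
      assume "\<not> ?thesis"
      then have "w = empty_words k" using w by (auto simp: empty_words_def words_def PiE_iff extensional_def)
      then show False using w by simp
    qed
    then have "defect_weight 1 [1..<Suc k] w = 0" by (auto simp: defect_weight_def prod_list_zero_iff)
    then show "complex_of_real (defect_weight 1 [1..<Suc k] w) * (coord f w * cnj (coord g w)) = 0" by simp
  next
    have "defect_weight 1 [1..<Suc k] (empty_words k) = 1"
      unfolding defect_weight_def prod.distinct_set_conv_list[OF distinct_upt, symmetric]
      by (intro prod.neutral) (auto simp: empty_words_def)
    then show "w \<in> words k n \<inter> {empty_words k} \<Longrightarrow>
      complex_of_real (defect_weight 1 [1..<Suc k] w) * (coord f w * cnj (coord g w)) = coord f w * cnj (coord g w)" for w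
      by auto
  qed (use empty_words_in in auto)
  then show ?thesis by simp
qed

text \<open>Letters are prepended because that is where the shifts act; removing a first letter
  lowers the total length.\<close>

lemma words_induct [consumes 1, case_names empty prepend]:
  assumes "w \<in> words k n"
    and "P (empty_words k)"
    and "\<And>w i s. w \<in> words k n \<Longrightarrow> i \<in> {1..k} \<Longrightarrow> s \<in> {1..n i} \<Longrightarrow> P w \<Longrightarrow> P (w(i := s # w i))"
  shows "P w"
  using assms(1)
proof (induction "\<Sum>i\<in>{1..k}. length (w i)" arbitrary: w rule: less_induct)
  case less
  show ?case
  proof (cases "\<forall>i\<in>{1..k}. w i = []")
    case True
    then have "w = empty_words k" using less.prems by (auto simp: empty_words_def words_def PiE_iff extensional_def)
    then show ?thesis using assms(2) by simp
  next
    case False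
    then obtain i s u where i: "i \<in> {1..k}" and su: "w i = s # u" by (auto simp: neq_Nil_conv)
    then have "s # u \<in> lists {1..n i}" using words_entry[OF less.prems i] by simp
    then have s: "s \<in> {1..n i}" and w': "w(i := u) \<in> words k n"
      using words_upd[OF less.prems i, of u] by auto
    have "(\<Sum>j\<in>{1..k}. length ((w(i := u)) j)) < (\<Sum>j\<in>{1..k}. length (w j))"
      using i su by (intro sum_strict_mono_ex1) auto
    then have "P (w(i := u))" using less.hyps w' by blast
    then have "P ((w(i := u))(i := s # (w(i := u)) i))" by (rule assms(3)[OF w' i s])
    moreover have "(w(i := u))(i := s # (w(i := u)) i) = w" using su by auto
    ultimately show ?thesis by simp
  qed
qed

section \<open>Defect operators\<close>

text \<open>\<open>Delta\<close> over an arbitrary index list, so that inductions can remove the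
  head, which is the outermost factor.\<close>

definition defect :: "(nat \<Rightarrow> nat) \<Rightarrow> real \<Rightarrow> (nat \<Rightarrow> nat \<Rightarrow> 'h \<Rightarrow> 'h) \<Rightarrow> nat list \<Rightarrow> 'h \<Rightarrow> 'h::chilbert_space"
  where "defect n r T l = foldr (\<lambda>i X x. X x - Phi n r T i X x) l (\<lambda>x. x)"

lemma Delta_eq_defect: "Delta k n r T = defect n r T [1..<Suc k]"
  by (simp add: Delta_def defect_def)

lemma defect_Nil [simp]: "defect n r T [] = (\<lambda>x. x)"
  by (simp add: defect_def)

lemma defect_Cons: "defect n r T (i # l) x = defect n r T l x - Phi n r T i (defect n r T l) x"
  by (simp add: defect_def)

lemma cinner_Phi:
  assumes "\<forall>s\<in>{1..n i}. bounded_clinear (T i s)"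
  shows "cinner (Phi n r T i X x) y
    = of_real (r\<^sup>2) * (\<Sum>s\<in>{1..n i}. cinner (X (cadjoint (T i s) x)) (cadjoint (T i s) y))"
  unfolding Phi_def cinner_sum_left sum_distrib_left
  by (intro sum.cong refl) (use assms in \<open>simp add: cinner_scaleR_left cinner_cadjoint\<close>)

lemma cinner_defect_Cons:
  assumes "\<forall>s\<in>{1..n i}. bounded_clinear (T i s)"
  shows "cinner (defect n r T (i # l) x) y = cinner (defect n r T l x) y -
    of_real (r\<^sup>2) * (\<Sum>s\<in>{1..n i}. cinner (defect n r T l (cadjoint (T i s) x)) (cadjoint (T i s) y))"
  by (simp only: defect_Cons cinner_diff_left cinner_Phi[of n i T, OF assms])

section \<open>Tuples modelled by the adjoint shifts\<close>

text \<open>The bound is uniform in \<open>h\<close>: the mass of \<open>f\<close> outside a large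
  finite set controls every \<open>h\<close> that vanishes on that set and is dominated by
  \<open>f\<close>. Purity of the model rests on this.\<close>

lemma norm_tail_small:
  fixes f :: "'a ell2"
  assumes "0 < \<epsilon>"
  shows "\<exists>F. finite F \<and> (\<forall>h. (\<forall>w\<in>F. coord h w = 0) \<and> (\<forall>w. cmod (coord h w) \<le> cmod (coord f w)) \<longrightarrow> norm h \<le> \<epsilon>)"
proof -
  let ?a = "\<lambda>w. (cmod (coord f w))\<^sup>2"
  have s: "?a summable_on UNIV" using coord[of f] by simp
  obtain F where F: "finite F" and d: "dist (sum ?a F) (infsum ?a UNIV) \<le> \<epsilon>\<^sup>2"
    using has_sum_finite_approximation[OF has_sum_infsum[OF s], of "\<epsilon>\<^sup>2"] assms by auto
  have "norm h \<le> \<epsilon>" if h: "\<forall>w\<in>F. coord h w = 0" "\<forall>w. cmod (coord h w) \<le> cmod (coord f w)" for h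
  proof (rule norm_ell2_leI)
    fix G :: "'a set" assume G: "finite G"
    have "(\<Sum>w\<in>G. (cmod (coord h w))\<^sup>2) = (\<Sum>w\<in>G - F. (cmod (coord h w))\<^sup>2)"
      using G h(1) by (intro sum.mono_neutral_right) auto
    also have "\<dots> \<le> sum ?a (G - F)" using h(2) by (intro sum_mono power_mono) auto
    also have "\<dots> = sum ?a (F \<union> G) - sum ?a F"
      using sum.union_disjoint[of F "G - F" ?a] F G by (simp add: Un_Diff_cancel)
    also have "\<dots> \<le> infsum ?a UNIV - sum ?a F"
      using F G s by (intro diff_right_mono finite_sum_le_infsum) auto
    also have "\<dots> \<le> \<epsilon>\<^sup>2" using d by (simp add: dist_real_def)
    finally show "L2_set (\<lambda>w. cmod (coord h w)) G \<le> \<epsilon>"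
      unfolding L2_set_def using assms by (intro real_le_lsqrt) (auto simp: sum_nonneg)
  qed
  then show ?thesis using F by blast
qed

text \<open>Truncation to \<open>D\<close> is a degenerate weighted shift, with the identity as
  index map and all phases 1.\<close>

lemma restriction_exists:
  fixes f :: "'a ell2"
  shows "\<exists>h. \<forall>w. coord h w = (if w \<in> D then coord f w else 0)"
proof -
  obtain A :: "'a ell2 \<Rightarrow> 'a ell2" where
    "\<forall>f w. coord (cadjoint A f) w = (if w \<in> D then cnj 1 * coord f w else 0)"
    using weighted_shift_exists[of "\<lambda>x. x" D "\<lambda>_. 1"] by auto
  then show ?thesis by (intro exI[of _ "cadjoint A f"]) simp
qed

text \<open>What a unitary onto a compression leaves once its range is forgotten: an isometry into
  the Fock space that intertwines the adjoints. This alone gives regularity, purity and, on a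
  nonzero space, rank one.\<close>

locale fock_model =
  fixes k :: nat and n :: "nat \<Rightarrow> nat" and lam :: "nat \<Rightarrow> nat \<Rightarrow> nat \<Rightarrow> nat \<Rightarrow> complex"
    and T :: "nat \<Rightarrow> nat \<Rightarrow> 'h::chilbert_space \<Rightarrow> 'h" and U :: "'h \<Rightarrow> (nat \<Rightarrow> nat list) ell2"
  assumes L: "Lambda_system k n lam"
    and T: "\<forall>i\<in>{1..k}. \<forall>s\<in>{1..n i}. bounded_clinear (T i s)"
    and U_add: "U (x + y) = U x + U y"
    and U_scale: "U (c *\<^sub>C x) = c *\<^sub>C U x"
    and U_cinner: "cinner (U x) (U y) = cinner x y"
    and U_fock: "U x \<in> fock k n"
    and U_adj: "i \<in> {1..k} \<Longrightarrow> s \<in> {1..n i} \<Longrightarrow> U (cadjoint (T i s) x) = cadjoint (std_shift k n lam i s) (U x)"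
begin

lemma cinner_defect:
  assumes r: "0 \<le> r" "r \<le> 1" and "set l \<subseteq> {1..k}" "distinct l"
  shows "cinner (defect n r T l x) y = diag_form k n (defect_weight r l) (U x) (U y)"
  using assms(3,4)
proof (induction l arbitrary: x y)
  case Nil
  have "defect_weight r [] = (\<lambda>_. 1)" by (rule ext) (simp add: defect_weight_def)
  then show ?case by (simp add: diag_form_one U_fock U_cinner)
next
  case (Cons i l)
  then have i: "i \<in> {1..k}" "i \<notin> set l" by auto
  have Ti: "\<forall>s\<in>{1..n i}. bounded_clinear (T i s)" using T i by blast
  show ?case
    unfolding cinner_defect_Cons[of n i T, OF Ti] diag_form_defect_Cons[OF L i r]
    using Cons by (simp add: U_adj[OF i(1)])
qed

lemma positive_defect:
  assumes "0 \<le> r" "r \<le> 1" "set l \<subseteq> {1..k}" "distinct l"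
  shows "positive_op (defect n r T l)"
  unfolding positive_op_def using diag_form_nonneg[OF defect_weight_bounds(2,1)] cinner_defect assms by simp

lemma U_inject: "U x = U y \<Longrightarrow> x = y"
proof -
  assume eq: "U x = U y"
  have "cinner x z = cinner y z" for z using eq U_cinner by metis
  then show "x = y" by (rule cinner_eqI)
qed

lemma norm_U: "norm (U x) = norm x"
proof -
  have "complex_of_real ((norm (U x))\<^sup>2) = complex_of_real ((norm x)\<^sup>2)"
    by (simp only: cinner_self[symmetric] U_cinner)
  then show ?thesis by (simp only: of_real_eq_iff) simp
qed

lemma commutation:
  assumes i: "i \<in> {1..k}" and j: "j \<in> {1..k}" and ij: "i \<noteq> j" and s: "s \<in> {1..n i}" and t: "t \<in> {1..n j}"
  shows "T i s (T j t x) = lam i j s t *\<^sub>C T j t (T i s x)"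
proof -
  let ?S = "\<lambda>i s. cadjoint (std_shift k n lam i s)"
  have lam: "lam j i t s = cnj (lam i j s t)" "cmod (lam i j s t) = 1"
    using L i j ij s t unfolding Lambda_system_def by blast+
  then have lam1: "lam i j s t * cnj (lam i j s t) = 1"
    using complex_norm_square[of "lam i j s t"] by simp
  \<comment> \<open>A letter added to the \<open>j\<close>-th word enters the phase of index
    \<open>i\<close> only for \<open>j < i\<close>. So exactly one of the two shifts picks up a
    factor, either \<open>lam i j s t\<close> or its conjugate.\<close>
  have ph: "shift_phase lam i s (w(j := t # w j)) = (if j < i then lam i j s t else 1) * shift_phase lam i s w"
    if "j \<ge> 1" "i \<noteq> j" for i j s t :: nat and w
  proof (cases "j < i")
    case True
    have "shift_phase lam i s (w(j := t # w j)) = (\<Prod>m\<in>{1..<i}. (if m = j then lam i j s t else 1) * lam_word lam i m s (w m))"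
      unfolding shift_phase_def by (rule prod.cong) (auto simp: lam_word_def)
    also have "\<dots> = lam i j s t * shift_phase lam i s w"
      using True that unfolding prod.distrib shift_phase_def by (subst prod.delta) auto
    finally show ?thesis using True by simp
  next
    case False
    then show ?thesis using that unfolding shift_phase_def by (auto intro!: prod.cong)
  qed
  have adj: "?S j t (?S i s f) = cnj (lam i j s t) *\<^sub>C ?S i s (?S j t f)" for f
  proof (rule ell2_eqI)
    fix w
    show "coord (?S j t (?S i s f)) w = coord (cnj (lam i j s t) *\<^sub>C ?S i s (?S j t f)) w"
    proof (cases "w \<in> words k n")
      case True
      have w: "w(i := s # w i) \<in> words k n" "w(j := t # w j) \<in> words k n"
        using words_upd[OF True] words_entry[OF True] i j s t by auto
      have sw: "w(i := s # w i, j := t # w j) = w(j := t # w j, i := s # w i)"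
        using ij by (rule fun_upd_twist)
      show ?thesis
        using True w ij ij[symmetric] i j lam lam1 ph[where i = i and j = j and s = s and t = t and w = w]
          ph[where i = j and j = i and s = t and t = s and w = w]
        by (cases "j < i") (simp_all add: coord_cadjoint_std_shift[OF L i s] coord_cadjoint_std_shift[OF L j t]
            scaleC_ell2.rep_eq sw mult_ac)
    next
      case False
      then show ?thesis
        by (simp add: coord_cadjoint_std_shift[OF L i s] coord_cadjoint_std_shift[OF L j t] scaleC_ell2.rep_eq)
    qed
  qed
  have Ti: "bounded_clinear (T i s)" and Tj: "bounded_clinear (T j t)" using T i j s t by auto
  have "cadjoint (T j t) (cadjoint (T i s) y) = cnj (lam i j s t) *\<^sub>C cadjoint (T i s) (cadjoint (T j t) y)" for y
    by (rule U_inject) (simp add: U_scale U_adj[OF i s] U_adj[OF j t] adj)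
  then show ?thesis
    by (intro cinner_eqI) (simp add: cinner_cadjoint[OF Ti] cinner_cadjoint[OF Tj] cinner_scaleC_left cinner_scaleC_right)
qed

lemma regular: "T \<in> regular_polyball k n lam"
proof -
  \<comment> \<open>The row contraction condition is the defect over a one-element list at
    \<open>r = 1\<close>.\<close>
  have "positive_op (\<lambda>x. x - (\<Sum>s\<in>{1..n i}. T i s (cadjoint (T i s) x)))" if "i \<in> {1..k}" for i
    using positive_defect[of 1 "[i]"] that by (simp add: defect_Cons[abs_def] Phi_def)
  moreover have "positive_op (Delta k n r T)" if "r \<in> {0..<1}" for r
    unfolding Delta_eq_defect by (rule positive_defect) (use that in auto)
  ultimately show ?thesis
    unfolding regular_polyball_def mem_Collect_eq using T commutation by (intro conjI) blast+
qed

text \<open>Each use of \<open>diag_form_shift\<close> raises the required length of the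
  \<open>i\<close>-th word by one, so the powers become truncations and purity becomes a tail
  estimate.\<close>

lemma cinner_Phi_power:
  assumes i: "i \<in> {1..k}"
  shows "cinner ((Phi n 1 T i ^^ q) (\<lambda>x. x) x) y
    = diag_form k n (\<lambda>w. if q \<le> length (w i) then 1 else 0) (U x) (U y)"
proof (induction q arbitrary: x y)
  case 0
  then show ?case by (simp add: diag_form_one U_fock U_cinner)
next
  case (Suc q)
  have Ti: "\<forall>s\<in>{1..n i}. bounded_clinear (T i s)" using T i by blast
  have b: "\<bar>if q \<le> length (w i) then 1 else 0\<bar> \<le> (1::real)" for w :: "nat \<Rightarrow> nat list" by simp
  have "cinner ((Phi n 1 T i ^^ Suc q) (\<lambda>x. x) x) y
      = diag_form k n (\<lambda>w. if w i = [] then 0 else if q \<le> length ((w(i := tl (w i))) i) then 1 else 0) (U x) (U y)"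
    unfolding funpow.simps comp_apply cinner_Phi[of n i T, OF Ti] Suc
    using diag_form_shift[OF L i b, where f = "U x" and g = "U y"] by (simp add: U_adj[OF i])
  also have "(\<lambda>w. if w i = [] then 0 else if q \<le> length ((w(i := tl (w i))) i) then 1 else 0)
      = (\<lambda>w :: nat \<Rightarrow> nat list. if Suc q \<le> length (w i) then 1 else (0::real))"
    by (rule ext) (auto simp: neq_Nil_conv)
  finally show ?case .
qed

lemma pure: "pure_tuple k n T"
  unfolding pure_tuple_def
proof (intro ballI allI)
  fix i x assume i: "i \<in> {1..k}"
  let ?P = "\<lambda>q. (Phi n 1 T i ^^ q) (\<lambda>x. x) x"
  \<comment> \<open>\<open>U\<close> intertwines only adjoints, so \<open>U (?P q)\<close> is in
    general not the truncation \<open>h\<close> of \<open>U x\<close> but its projection to the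
    range. Testing against \<open>?P q\<close> itself gives the norm bound.\<close>
  have bound: "norm (?P q) \<le> norm h"
    if h: "\<forall>w. coord h w = (if w \<in> {w. w \<in> words k n \<and> q \<le> length (w i)} then coord (U x) w else 0)" for h q
  proof (cases "?P q = 0")
    case False
    have "diag_form k n (\<lambda>w. if q \<le> length (w i) then 1 else 0) (U x) g = cinner h g" for g
      unfolding diag_form_def cinner_ell2.rep_eq by (rule infsum_cong_neutral) (auto simp: h)
    then have "complex_of_real ((norm (?P q))\<^sup>2) = cinner h (U (?P q))"
      unfolding cinner_self[symmetric] cinner_Phi_power[OF i] by simp
    then have "(norm (?P q))\<^sup>2 = cmod (cinner h (U (?P q)))"
      by (metis abs_power2 norm_of_real)
    also have "\<dots> \<le> norm h * norm (?P q)" using cauchy_schwarz[of h "U (?P q)"] by (simp add: norm_U)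
    finally show ?thesis using False by (simp add: power2_eq_square)
  qed simp
  show "?P \<longlonglongrightarrow> 0"
  proof (rule metric_LIMSEQ_I)
    fix \<epsilon> :: real assume \<epsilon>: "0 < \<epsilon>"
    obtain F where F: "finite F" and small: "\<And>h. (\<forall>w\<in>F. coord h w = 0) \<Longrightarrow>
        (\<forall>w. cmod (coord h w) \<le> cmod (coord (U x) w)) \<Longrightarrow> norm h \<le> \<epsilon> / 2"
      using norm_tail_small[of "\<epsilon> / 2" "U x"] \<epsilon> by auto
    \<comment> \<open>\<open>N\<close> exceeds the length of the \<open>i\<close>-th word of every
      member of \<open>F\<close>, so for \<open>q \<ge> N\<close> the truncation vanishes on
      \<open>F\<close>.\<close>
    define N where "N = Suc (\<Sum>w\<in>F. length (w i))"
    have "dist (?P q) 0 < \<epsilon>" if q: "q \<ge> N" for q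
    proof -
      obtain h where h: "\<forall>w. coord h w = (if w \<in> {w. w \<in> words k n \<and> q \<le> length (w i)} then coord (U x) w else 0)"
        using restriction_exists[of "{w. w \<in> words k n \<and> q \<le> length (w i)}" "U x"] by auto
      have "length (w i) < q" if "w \<in> F" for w
        using member_le_sum[of w F "\<lambda>w. length (w i)"] that F q unfolding N_def by simp
      then have "norm h \<le> \<epsilon> / 2" by (intro small) (auto simp: h dest: leD)
      then show ?thesis using bound[OF h] \<epsilon> by simp
    qed
    then show "\<exists>N. \<forall>q\<ge>N. dist (?P q) 0 < \<epsilon>" by blast
  qed
qed

text \<open>The vector \<open>v\<close> represents the vacuum coefficient of \<open>U x\<close>, so
  the defect is the rank-one form of \<open>v\<close> as soon as \<open>v\<close> is nonzero. The
  assumption excludes the zero space, where the defect has rank 0 although the zero subspace is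
  co-invariant.\<close>

lemma rank_one:
  assumes "\<exists>x::'h. x \<noteq> 0"
  shows "rank_op (Delta k n 1 T) = 1"
proof -
  let ?e = "empty_words k"
  have "bounded_linear U"
    by (rule bounded_linear_intro[where K = 1]) (simp_all add: U_add scaleR_scaleC U_scale norm_U)
  then have "\<exists>v. \<forall>x. cinner (U x) (chi ?e) = cinner x v"
    by (intro riesz_representation bounded_linear_compose[OF bounded_linear_cinner_left])
      (simp_all add: U_scale cinner_scaleC_left)
  then obtain v where v: "\<And>x. coord (U x) ?e = cinner x v" unfolding cinner_chi by blast
  have D: "Delta k n 1 T x = cinner x v *\<^sub>C v" for x
  proof (rule cinner_eqI)
    fix y
    have "cinner (Delta k n 1 T x) y = diag_form k n (defect_weight 1 [1..<Suc k]) (U x) (U y)"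
      unfolding Delta_eq_defect by (rule cinner_defect) auto
    also have "\<dots> = cinner x v * cnj (cinner y v)"
      unfolding diag_form_defect_one v ..
    also have "\<dots> = cinner (cinner x v *\<^sub>C v) y" by (simp add: cinner_scaleC_left flip: cinner_commute)
    finally show "cinner (Delta k n 1 T x) y = cinner (cinner x v *\<^sub>C v) y" .
  qed
  \<comment> \<open>Otherwise the vacuum coefficient vanishes on the range of \<open>U\<close>; the
    adjoint shifts preserve this range, so induction along words makes all coordinates
    vanish.\<close>
  have "v \<noteq> 0"
  proof
    assume "v = 0"
    then have e: "coord (U x) ?e = 0" for x using v by simp
    have zero: "coord (U x) w = 0" if "w \<in> words k n" for w x
      using that
    proof (induction w arbitrary: x rule: words_induct)
      case (prepend w i s)
      then show ?case unfolding coord_upd_eq[OF L prepend(2,3,1)] by (simp flip: U_adj)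
    qed (rule e)
    have "U x = 0" for x
      using zero U_fock[of x] by (intro ell2_eqI) (auto simp: fock_def zero_ell2.rep_eq)
    then show False using assms norm_U by (metis norm_eq_zero)
  qed
  have "range (Delta k n 1 T) = complex_vector.span {v}"
  proof
    show "range (Delta k n 1 T) \<subseteq> complex_vector.span {v}"
      by (auto simp: D complex_vector.span_singleton)
    show "complex_vector.span {v} \<subseteq> range (Delta k n 1 T)"
    proof
      fix x assume "x \<in> complex_vector.span {v}"
      then obtain c where "x = c *\<^sub>C v" by (auto simp: complex_vector.span_singleton)
      then have "x = Delta k n 1 T ((c / (norm v)\<^sup>2) *\<^sub>C v)"
        using \<open>v \<noteq> 0\<close> by (simp add: D cinner_scaleC_left cinner_self)
      then show "x \<in> range (Delta k n 1 T)" by blast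
    qed
  qed
  moreover have "\<not> complex_vector.dependent {v}" using \<open>v \<noteq> 0\<close> by simp
  ultimately show ?thesis
    unfolding rank_op_def by (simp add: complex_vector.dim_eq_card_independent)
qed

end

section \<open>Unitary equivalence with compressions\<close>

lemma coinvariantD:
  assumes "coinvariant k n lam M"
  shows "closed_csubspace M" "M \<subseteq> fock k n"
    "i \<in> {1..k} \<Longrightarrow> s \<in> {1..n i} \<Longrightarrow> x \<in> M \<Longrightarrow> cadjoint (std_shift k n lam i s) x \<in> M"
  using assms unfolding coinvariant_def by (simp, simp, blast)

lemma unitary_ontoD:
  assumes "unitary_onto V W U"
  shows "x \<in> V \<Longrightarrow> y \<in> V \<Longrightarrow> U (x + y) = U x + U y" "x \<in> V \<Longrightarrow> U (c *\<^sub>C x) = c *\<^sub>C U x"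
    "x \<in> V \<Longrightarrow> y \<in> V \<Longrightarrow> cinner (U x) (U y) = cinner x y" "U ` V = W"
  using assms unfolding unitary_onto_def by auto

lemma cinner_compression:
  assumes L: "Lambda_system k n lam" and M: "coinvariant k n lam M" and i: "i \<in> {1..k}" "s \<in> {1..n i}"
    and y: "y \<in> M"
  shows "cinner (compression M (std_shift k n lam) i s x) y = cinner x (cadjoint (std_shift k n lam i s) y)"
    and "cinner y (compression M (std_shift k n lam) i s x) = cinner (cadjoint (std_shift k n lam i s) y) x"
  using coinvariantD(1)[OF M] y bounded_clinear_std_shift[OF L i]
  by (simp_all add: compression_def cinner_proj_left cinner_proj_right cinner_cadjoint cinner_cadjoint')

text \<open>\<open>B\<close> plays the role of \<open>A\<^sup>* x\<close>.\<close>

lemma intertwine_adjoint: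
  assumes L: "Lambda_system k n lam" and W: "coinvariant k n lam W"
    and U: "unitary_onto V W U" and i: "i \<in> {1..k}" "s \<in> {1..n i}"
    and AB: "\<And>y. y \<in> V \<Longrightarrow> cinner x (A y) = cinner B y" and V: "\<And>y. y \<in> V \<Longrightarrow> A y \<in> V" "x \<in> V" "B \<in> V"
    and int: "\<And>y. y \<in> V \<Longrightarrow> U (A y) = compression W (std_shift k n lam) i s (U y)"
  shows "U B = cadjoint (std_shift k n lam i s) (U x)"
proof -
  note UD = unitary_ontoD[OF U] and WD = coinvariantD[OF W]
  let ?B = "cadjoint (std_shift k n lam i s) (U x)"
  have UW: "U y \<in> W" if "y \<in> V" for y using UD(4) that by blast
  have eq: "cinner (U B) z = cinner ?B z" if "z \<in> W" for z
  proof -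
    obtain y where y: "y \<in> V" "z = U y" using \<open>z \<in> W\<close> UD(4) by blast
    have "cinner (U B) z = cinner x (A y)" by (simp add: y UD(3) V AB)
    also have "\<dots> = cinner (U x) (U (A y))" by (simp add: y UD(3) V)
    also have "\<dots> = cinner ?B z" using y by (simp add: int cinner_compression[OF L W i] UW V)
    finally show ?thesis .
  qed
  \<comment> \<open>Co-invariance puts the difference into \<open>W\<close>, so testing against
    \<open>W\<close> is enough.\<close>
  have "U B - ?B \<in> W" using UW V WD i by (intro closed_csubspaceD[OF WD(1)]) auto
  from eq[OF this] have "cinner (U B - ?B) (U B - ?B) = 0" by (simp add: cinner_diff_left)
  then show ?thesis by (simp add: cinner_self)
qed

lemma fock_model_of_equivalence:
  fixes T :: "nat \<Rightarrow> nat \<Rightarrow> 'h::chilbert_space \<Rightarrow> 'h"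
  assumes L: "Lambda_system k n lam" and T: "\<forall>i\<in>{1..k}. \<forall>s\<in>{1..n i}. bounded_clinear (T i s)"
    and M: "coinvariant k n lam M"
    and eq: "unitarily_equivalent k n UNIV T M (compression M (std_shift k n lam))"
  shows "\<exists>U. fock_model k n lam T U"
proof -
  obtain U where U: "unitary_onto UNIV M U"
    and int: "\<forall>i\<in>{1..k}. \<forall>s\<in>{1..n i}. \<forall>x. U (T i s x) = compression M (std_shift k n lam) i s (U x)"
    using eq unfolding unitarily_equivalent_def by auto
  note UD = unitary_ontoD[OF U]
  have "fock_model k n lam T U"
  proof
    fix i s x assume i: "i \<in> {1..k}" "s \<in> {1..n i}"
    have Ti: "bounded_clinear (T i s)" using T i by blast
    show "U (cadjoint (T i s) x) = cadjoint (std_shift k n lam i s) (U x)"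
      by (rule intertwine_adjoint[OF L M U i, where A = "T i s"]) (use int i in \<open>auto simp: cinner_cadjoint'[OF Ti]\<close>)
  qed (use L T UD coinvariantD(2)[OF M] in auto)
  then show ?thesis by blast
qed

lemma compression_in: "coinvariant k n lam M \<Longrightarrow> compression M A i s x \<in> M"
  unfolding compression_def by (intro proj_props coinvariantD)

lemma coinvariant_unique:
  assumes L: "Lambda_system k n lam" and M: "coinvariant k n lam M" and M': "coinvariant k n lam M'"
    and eq: "unitarily_equivalent k n M (compression M (std_shift k n lam)) M' (compression M' (std_shift k n lam))"
  shows "M = M'"
proof -
  let ?S = "\<lambda>i s. cadjoint (std_shift k n lam i s)" and ?e = "empty_words k"
  obtain V where V: "unitary_onto M M' V"
    and int: "\<forall>i\<in>{1..k}. \<forall>s\<in>{1..n i}. \<forall>x\<in>M.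
      V (compression M (std_shift k n lam) i s x) = compression M' (std_shift k n lam) i s (V x)"
    using eq unfolding unitarily_equivalent_def by auto
  note VD = unitary_ontoD[OF V] and MD = coinvariantD[OF M] and MD' = coinvariantD[OF M']
  note sub = closed_csubspaceD[OF MD(1)]
  have VM: "V x \<in> M'" if "x \<in> M" for x using VD(4) that by blast
  have adj: "V (?S i s x) = ?S i s (V x)" if "i \<in> {1..k}" "s \<in> {1..n i}" "x \<in> M" for i s x
    by (rule intertwine_adjoint[OF L M' V that(1,2), where A = "compression M (std_shift k n lam) i s"])
      (use that int in \<open>auto simp: cinner_compression[OF L M that(1,2)] compression_in[OF M] MD(3)\<close>)
  \<comment> \<open>The recursion is run on forms of vectors in \<open>M\<close> and
    \<open>M'\<close>: co-invariance keeps each step inside these spaces, and \<open>adj\<close>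
    matches the two sides.\<close>
  have form: "diag_form k n (defect_weight 1 l) (V x) (V y) = diag_form k n (defect_weight 1 l) x y"
    if "set l \<subseteq> {1..k}" "distinct l" "x \<in> M" "y \<in> M" for l x y
    using that
  proof (induction l arbitrary: x y)
    case Nil
    have "defect_weight 1 [] = (\<lambda>_. 1)" by (rule ext) (simp add: defect_weight_def)
    moreover have "V x \<in> fock k n" "x \<in> fock k n" using VM Nil MD(2) MD'(2) by auto
    ultimately show ?case using Nil by (simp add: diag_form_one VD(3))
  next
    case (Cons i l)
    then have i: "i \<in> {1..k}" "i \<notin> set l" by auto
    have "diag_form k n (defect_weight 1 l) (?S i s (V x)) (?S i s (V y))
        = diag_form k n (defect_weight 1 l) (?S i s x) (?S i s y)" if s: "s \<in> {1..n i}" for s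
      using Cons by (simp add: MD(3)[OF i(1) s] flip: adj[OF i(1) s])
    then show ?case
      using Cons by (simp add: diag_form_defect_Cons[OF L i])
  qed
  have e: "coord (V x) ?e * cnj (coord (V y) ?e) = coord x ?e * cnj (coord y ?e)" if "x \<in> M" "y \<in> M" for x y
    by (rule form[of "[1..<Suc k]", unfolded diag_form_defect_one, OF _ _ that]) auto
  \<comment> \<open>A vector \<open>y\<close> with nonzero vacuum coefficient determines the
    constant by \<open>e\<close> with second argument \<open>y\<close>; taking both arguments equal
    to \<open>y\<close> gives modulus 1. If there is no such vector, any unimodular constant
    serves.\<close>
  have "\<exists>c. cmod c = 1 \<and> (\<forall>x\<in>M. coord (V x) ?e = c * coord x ?e)"
  proof (cases "\<forall>x\<in>M. coord x ?e = 0")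
    case True
    then have "coord (V x) ?e = 0" if "x \<in> M" for x using e[OF that that] that by simp
    then show ?thesis using True by (intro exI[of _ 1]) simp
  next
    case False
    then obtain y where y: "y \<in> M" "coord y ?e \<noteq> 0" by blast
    have "complex_of_real ((cmod (coord (V y) ?e))\<^sup>2) = complex_of_real ((cmod (coord y ?e))\<^sup>2)"
      unfolding complex_norm_square by (rule e[OF y(1) y(1)])
    then have "(cmod (coord (V y) ?e))\<^sup>2 = (cmod (coord y ?e))\<^sup>2" by (simp only: of_real_eq_iff)
    then have n: "cmod (coord (V y) ?e) = cmod (coord y ?e)" by (simp add: power2_eq_iff_nonneg)
    then have "coord (V y) ?e \<noteq> 0" using y by auto
    then have "\<forall>x\<in>M. coord (V x) ?e = (cnj (coord y ?e) / cnj (coord (V y) ?e)) * coord x ?e"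
      using e y by (simp add: field_simps)
    moreover have "cmod (cnj (coord y ?e) / cnj (coord (V y) ?e)) = 1" using n y by (simp add: norm_divide)
    ultimately show ?thesis by blast
  qed
  then obtain c where c: "cmod c = 1" and Ve: "\<And>x. x \<in> M \<Longrightarrow> coord (V x) ?e = c * coord x ?e" by blast
  have Vw: "coord (V x) w = c * coord x w" if "w \<in> words k n" "x \<in> M" for w x
    using that
  proof (induction w arbitrary: x rule: words_induct)
    case (prepend w i s)
    have "shift_phase lam i s w * coord (?S i s (V x)) w = shift_phase lam i s w * coord (V (?S i s x)) w"
      by (simp add: adj[OF prepend(2,3,5)])
    also have "\<dots> = c * (shift_phase lam i s w * coord (?S i s x) w)"
      using prepend MD(3) by simp
    finally show ?case unfolding coord_upd_eq[OF L prepend(2,3,1)] .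
  qed (rule Ve)
  have Vc: "V x = c *\<^sub>C x" if "x \<in> M" for x
  proof (rule ell2_eqI)
    fix w
    show "coord (V x) w = coord (c *\<^sub>C x) w"
      using VM[OF that] that MD(2) MD'(2) Vw[OF _ that, of w]
      by (cases "w \<in> words k n") (auto simp: scaleC_ell2.rep_eq fock_def subset_iff)
  qed
  \<comment> \<open>A nonzero multiple of the identity maps \<open>M\<close> onto itself, whereas
    \<open>V\<close> maps it onto \<open>M'\<close>.\<close>
  have "c \<noteq> 0" using c by auto
  have "x \<in> V ` M" if "x \<in> M" for x
  proof (rule image_eqI)
    show "(1 / c) *\<^sub>C x \<in> M" using that by (rule sub)
    then show "x = V ((1 / c) *\<^sub>C x)" using \<open>c \<noteq> 0\<close> by (simp add: Vc scaleC_scaleC scaleC_one)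
  qed
  moreover have "V ` M \<subseteq> M" using Vc sub(5) by auto
  ultimately show ?thesis using VD(4) by blast
qed

section \<open>The Poisson embedding of a pure element\<close>

lemma bounded_clinear_compose: "bounded_clinear f \<Longrightarrow> bounded_clinear g \<Longrightarrow> bounded_clinear (\<lambda>x. f (g x))"
  unfolding bounded_clinear_def by (auto intro: bounded_linear_compose)

lemma bounded_clinear_diff: "bounded_clinear f \<Longrightarrow> bounded_clinear g \<Longrightarrow> bounded_clinear (\<lambda>x. f x - g x)"
  unfolding bounded_clinear_def by (auto intro: bounded_linear_sub simp: complex_vector.scale_right_diff_distrib)

lemma bounded_clinear_sum:
  "(\<And>s. s \<in> I \<Longrightarrow> bounded_clinear (f s)) \<Longrightarrow> bounded_clinear (\<lambda>x. \<Sum>s\<in>I. f s x)"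
  unfolding bounded_clinear_def by (auto intro: bounded_linear_sum simp: complex_vector.scale_sum_right)

lemma bounded_clinear_scaleR: "bounded_clinear f \<Longrightarrow> bounded_clinear (\<lambda>x. r *\<^sub>R f x)"
  unfolding bounded_clinear_def
  by (intro conjI allI bounded_linear_const_scaleR) (auto simp: scaleR_scaleC scaleC_scaleC mult.commute)

lemma bounded_clinear_ident: "bounded_clinear (\<lambda>x. x)"
  unfolding bounded_clinear_def by auto

lemma bounded_clinear_form_bound:
  assumes "bounded_clinear X"
  shows "\<exists>C. \<forall>y. cmod (cinner (X y) y) \<le> C * (norm y)\<^sup>2"
proof -
  obtain C where C: "\<And>y. norm (X y) \<le> norm y * C"
    using bounded_linear.bounded[OF bounded_clinearD(1)[OF assms]] by auto
  have "cmod (cinner (X y) y) \<le> C * (norm y)\<^sup>2" for y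
  proof -
    have "cmod (cinner (X y) y) \<le> norm (X y) * norm y" by (rule cauchy_schwarz)
    also have "\<dots> \<le> norm y * C * norm y" by (intro mult_right_mono C) simp
    finally show ?thesis by (simp add: power2_eq_square mult_ac)
  qed
  then show ?thesis by blast
qed

text \<open>For nonnegative terms, convergence along one exhausting sequence of finite sets gives
  the unordered sum. The sequence will be the words of bounded length.\<close>

lemma has_sum_exhaustion:
  fixes h :: "'a \<Rightarrow> real" and F :: "nat \<Rightarrow> 'a set"
  assumes nonneg: "\<And>u. u \<in> S \<Longrightarrow> 0 \<le> h u"
    and F: "\<And>N. finite (F N)" "\<And>N. F N \<subseteq> S" "\<And>N. F N \<subseteq> F (Suc N)"
    and exhaust: "\<And>G. finite G \<Longrightarrow> G \<subseteq> S \<Longrightarrow> \<exists>N. G \<subseteq> F N"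
    and lim: "(\<lambda>N. sum h (F N)) \<longlonglongrightarrow> L"
  shows "(h has_sum L) S"
proof -
  have "incseq (\<lambda>N. sum h (F N))"
    by (intro incseq_SucI sum_mono2) (use F nonneg in blast)+
  then have le: "sum h (F N) \<le> L" for N using lim by (rule incseq_le)
  have leG: "sum h G \<le> L" if G: "finite G" "G \<subseteq> S" for G
  proof -
    obtain N where "G \<subseteq> F N" using exhaust G by blast
    then have "sum h G \<le> sum h (F N)" by (intro sum_mono2) (use F nonneg in blast)+
    then show ?thesis using le order_trans by blast
  qed
  have s: "h summable_on S"
    using leG by (intro nonneg_bdd_above_summable_on nonneg bdd_aboveI2[where M = L]) auto
  have "infsum h S \<le> L" using s leG by (intro infsum_le_finite_sums) auto
  moreover have "L \<le> infsum h S"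
    using lim by (rule LIMSEQ_le_const2) (use F s nonneg in \<open>auto intro!: exI finite_sum_le_infsum\<close>)
  ultimately show ?thesis using has_sum_infsum[OF s] by simp
qed

text \<open>Adjoining one index turns an iterated sum into a sum over tuples of words. The inverse
  resets the entry to \<open>undefined\<close>, the value of extensional functions off
  \<open>I\<close>.\<close>

lemma bij_betw_PiE_upd:
  assumes "i \<notin> I"
  shows "bij_betw (\<lambda>(w, u). w(i := u)) (Sigma (Pi\<^sub>E I G) (\<lambda>_. G i)) (Pi\<^sub>E (insert i I) G)"
  using assms
  by (intro bij_betw_byWitness[where f' = "\<lambda>w. (w(i := undefined), w i)"])
    (auto simp: PiE_iff extensional_def fun_eq_iff split: if_splits)

definition length_words :: "nat \<Rightarrow> nat \<Rightarrow> nat list set"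
  where "length_words m N = {u. set u \<subseteq> {1..m} \<and> length u = N}"

lemma finite_length_words: "finite (length_words m N)"
  unfolding length_words_def by (rule finite_lists_length_eq) simp

lemma length_words_0 [simp]: "length_words m 0 = {[]}"
  by (auto simp: length_words_def)

lemma sum_length_words_Cons:
  "sum f (length_words m (Suc N)) = (\<Sum>s\<in>{1..m}. \<Sum>u\<in>length_words m N. f (s # u))"
  unfolding sum.cartesian_product
  by (rule sum.reindex_bij_witness[where i = "\<lambda>(s, u). s # u" and j = "\<lambda>u. (hd u, tl u)"])
    (auto simp: length_words_def length_Suc_conv)

text \<open>Powers of \<open>Phi\<close> split off the first letter, whose adjoint acts first;
  telescoping extends a word at its end, where the new adjoint acts last. Hence both
  decompositions.\<close>

lemma sum_length_words_snoc:
  "sum f (length_words m (Suc N)) = (\<Sum>u\<in>length_words m N. \<Sum>s\<in>{1..m}. f (u @ [s]))"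
  unfolding sum.cartesian_product
  by (rule sum.reindex_bij_witness[where i = "\<lambda>(u, s). u @ [s]" and j = "\<lambda>u. (butlast u, last u)"])
    (auto simp: length_words_def length_Suc_conv_rev)

section \<open>Defects of bounded tuples and their limit at r = 1\<close>

lemma continuous_cinner_defect:
  assumes T: "\<forall>i\<in>{1..k}. \<forall>s\<in>{1..n i}. bounded_clinear (T i s)" and "set l \<subseteq> {1..k}"
  shows "continuous_on UNIV (\<lambda>r. cinner (defect n r T l x) y)"
  using assms(2)
proof (induction l arbitrary: x y)
  case (Cons i l)
  then have Ti: "\<forall>s\<in>{1..n i}. bounded_clinear (T i s)" using T by auto
  show ?case
    unfolding cinner_defect_Cons[of n i T, OF Ti] using Cons by (auto intro!: continuous_intros)
qed simp

text \<open>The polyball condition stops short of \<open>r = 1\<close>, where the rank is taken. For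
  fixed vectors the form is a polynomial in \<open>r\<close>, and the nonnegative reals are
  closed.\<close>

lemma positive_defect_one:
  assumes T: "\<forall>i\<in>{1..k}. \<forall>s\<in>{1..n i}. bounded_clinear (T i s)" and l: "set l \<subseteq> {1..k}"
    and pos: "\<forall>r\<in>{0..<1}. positive_op (defect n r T l)"
  shows "positive_op (defect n 1 T l)"
  unfolding positive_op_def
proof
  fix x
  let ?f = "\<lambda>r. cinner (defect n r T l x) x"
  have "(?f \<longlongrightarrow> ?f 1) (at_left 1)"
    using continuous_cinner_defect[of k n T, OF T l, of x x] unfolding continuous_on_def
    by (meson UNIV_I tendsto_within_subset subset_UNIV)
  moreover have "\<forall>\<^sub>F r in at_left 1. ?f r \<in> \<real>\<^sub>\<ge>\<^sub>0"
    using eventually_at_left_real[OF zero_less_one] by eventually_elim (use pos in \<open>auto simp: positive_op_def\<close>)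
  ultimately show "?f 1 \<in> \<real>\<^sub>\<ge>\<^sub>0"
    using closed_nonneg_Reals_complex by (intro Lim_in_closed_set[of _ ?f "at_left (1::real)"]) auto
qed

lemma defect_selfadjoint:
  assumes T: "\<forall>i\<in>{1..k}. \<forall>s\<in>{1..n i}. bounded_clinear (T i s)" and "set l \<subseteq> {1..k}"
  shows "cinner (defect n r T l x) y = cinner x (defect n r T l y)"
proof -
  have "cinner (defect n r T l x) y = cnj (cinner (defect n r T l y) x)"
    using assms(2)
  proof (induction l arbitrary: x y)
    case Nil
    then show ?case by (simp flip: cinner_commute)
  next
    case (Cons i l)
    then have Ti: "\<forall>s\<in>{1..n i}. bounded_clinear (T i s)" using T by auto
    have IH: "cinner (defect n r T l x) y = cnj (cinner (defect n r T l y) x)" for x y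
      by (rule Cons.IH) (use Cons.prems in auto)
    have "(\<Sum>s\<in>{1..n i}. cinner (defect n r T l (cadjoint (T i s) x)) (cadjoint (T i s) y))
        = (\<Sum>s\<in>{1..n i}. cnj (cinner (defect n r T l (cadjoint (T i s) y)) (cadjoint (T i s) x)))"
      by (rule sum.cong[OF refl IH])
    then show ?case
      unfolding cinner_defect_Cons[of n i T, OF Ti] by (simp add: IH[of x y])
  qed
  then show ?thesis by (simp flip: cinner_commute)
qed

lemma bounded_clinear_defect:
  assumes T: "\<forall>i\<in>{1..k}. \<forall>s\<in>{1..n i}. bounded_clinear (T i s)" and "set l \<subseteq> {1..k}"
  shows "bounded_clinear (defect n r T l)"
  using assms(2)
proof (induction l)
  case (Cons i l)
  then have Ti: "\<And>s. s \<in> {1..n i} \<Longrightarrow> bounded_clinear (T i s)" using T by auto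
  have X: "bounded_clinear (defect n r T l)" using Cons by simp
  have "bounded_clinear (\<lambda>x. r\<^sup>2 *\<^sub>R T i s (defect n r T l (cadjoint (T i s) x)))" if s: "s \<in> {1..n i}" for s
    by (rule bounded_clinear_scaleR[OF bounded_clinear_compose[OF Ti[OF s]
          bounded_clinear_compose[OF X bounded_clinear_cadjoint[OF Ti[OF s]]]]])
  then have "bounded_clinear (\<lambda>x. defect n r T l x - (\<Sum>s\<in>{1..n i}. r\<^sup>2 *\<^sub>R T i s (defect n r T l (cadjoint (T i s) x))))"
    by (intro bounded_clinear_diff bounded_clinear_sum X)
  then show ?case by (simp add: defect_Cons[abs_def] Phi_def)
qed (simp add: bounded_clinear_ident)

text \<open>If the range lies on the line of \<open>b\<close>, self-adjointness turns the
  coefficient into \<open>a * cinner x b\<close> and positivity at \<open>b\<close> makes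
  \<open>a\<close> nonnegative, so its square root can be absorbed into \<open>b\<close>.\<close>

lemma rank_one_positive:
  assumes bdd: "bounded_clinear X" and pos: "positive_op X"
    and sa: "\<And>x y. cinner (X x) y = cinner x (X y)" and rank: "rank_op X = 1"
  shows "\<exists>v. \<forall>x. X x = cinner x v *\<^sub>C v"
proof -
  obtain b where "range X \<subseteq> complex_vector.span {b}"
    using complex_vector.basis_exists[of "range X"] rank unfolding rank_op_def
    by (metis One_nat_def card_1_singletonE)
  then have "\<exists>c. X x = c *\<^sub>C b" for x by (auto simp: complex_vector.span_singleton)
  then obtain f where f: "\<And>x. X x = f x *\<^sub>C b" by metis
  show ?thesis
  proof (cases "b = 0")
    case True
    then show ?thesis using f by (intro exI[of _ 0]) simp
  next
    case False
    then have bb: "cinner b b \<noteq> 0" by (simp add: cinner_self)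
    \<comment> \<open>Read off from \<open>cinner (X x) b = cinner x (X b)\<close>.\<close>
    define a where "a = cnj (f b) / cinner b b"
    have fx: "f x = a * cinner x b" for x
      using sa[of x b] bb by (simp add: f cinner_scaleC_left cinner_scaleC_right a_def field_simps)
    have "cinner (X b) b \<in> \<real>\<^sub>\<ge>\<^sub>0" using pos by (simp add: positive_op_def)
    then obtain q where q: "q \<ge> 0" "a * (cinner b b * cinner b b) = complex_of_real q"
      by (auto simp: f fx cinner_scaleC_left nonneg_Reals_def mult_ac elim!: Reals_cases)
    \<comment> \<open>\<open>cinner (X b) b\<close> is \<open>a\<close> times the fourth power of
      the norm of \<open>b\<close>.\<close>
    have "a = complex_of_real (q / (norm b) ^ 4)"
      using q(2) False by (simp add: cinner_self field_simps power4_eq_xxxx power2_eq_square)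
    moreover define t where "t = sqrt (q / (norm b) ^ 4)"
    have "t\<^sup>2 = q / (norm b) ^ 4" using q(1) by (simp add: t_def)
    ultimately have a: "a = complex_of_real t * complex_of_real t" by (simp add: power2_eq_square flip: of_real_mult)
    have "X x = cinner x (t *\<^sub>R b) *\<^sub>C (t *\<^sub>R b)" for x
      by (simp add: f fx a cinner_scaleC_right scaleR_scaleC scaleC_scaleC mult_ac)
    then show ?thesis by blast
  qed
qed

section \<open>Telescoping over words for a pure element\<close>

locale pure_element =
  fixes k :: nat and n :: "nat \<Rightarrow> nat" and lam :: "nat \<Rightarrow> nat \<Rightarrow> nat \<Rightarrow> nat \<Rightarrow> complex"
    and T :: "nat \<Rightarrow> nat \<Rightarrow> 'h::chilbert_space \<Rightarrow> 'h"
  assumes L: "Lambda_system k n lam"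
    and regular: "T \<in> regular_polyball k n lam"
    and pure: "pure_tuple k n T"
begin

abbreviation "A i s \<equiv> cadjoint (T i s)"
text \<open>With \<open>fold\<close> the first letter acts first, so this is the adjoint of the
  product of the \<open>T i s\<close> along \<open>u\<close>.\<close>

abbreviation "B i u \<equiv> fold (A i) u"
abbreviation "D l \<equiv> defect n 1 T l"

lemma T: "\<forall>i\<in>{1..k}. \<forall>s\<in>{1..n i}. bounded_clinear (T i s)"
  using regular by (simp add: regular_polyball_def)

lemma bounded_clinear_A: "i \<in> {1..k} \<Longrightarrow> s \<in> {1..n i} \<Longrightarrow> bounded_clinear (A i s)"
  using T bounded_clinear_cadjoint by blast

lemma bounded_clinear_B: "i \<in> {1..k} \<Longrightarrow> u \<in> lists {1..n i} \<Longrightarrow> bounded_clinear (B i u)"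
proof (induction u)
  case (Cons s u)
  then have "bounded_clinear (\<lambda>x. B i u (A i s x))"
    using bounded_clinear_compose[of "B i u" "A i s"] bounded_clinear_A by auto
  then show ?case by (simp add: comp_def)
qed (simp add: bounded_clinear_ident id_def)

lemma cinner_Phi_power_words:
  assumes i: "i \<in> {1..k}"
  shows "cinner ((Phi n 1 T i ^^ N) (\<lambda>x. x) x) y = (\<Sum>u\<in>length_words (n i) N. cinner (B i u x) (B i u y))"
proof (induction N arbitrary: x y)
  case (Suc N)
  have Ti: "\<forall>s\<in>{1..n i}. bounded_clinear (T i s)" using T i by blast
  show ?case
    unfolding funpow.simps comp_apply cinner_Phi[of n i T, OF Ti] Suc sum_length_words_Cons by simp
qed simp

text \<open>Telescoping along the word length; purity removes the remainder.\<close>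

lemma defect_has_sum:
  assumes i: "i \<in> {1..k}" and l: "set l \<subseteq> {1..k}" and pos: "\<And>y. 0 \<le> Re (cinner (D (i # l) y) y)"
  shows "((\<lambda>u. Re (cinner (D (i # l) (B i u x)) (B i u x))) has_sum Re (cinner (D l x) x)) (lists {1..n i})"
proof (rule has_sum_exhaustion[where F = "\<lambda>N. \<Union>m<N. length_words (n i) m"])
  define h where "h u = Re (cinner (D (i # l) (B i u x)) (B i u x))" for u
  define q where "q u = Re (cinner (D l (B i u x)) (B i u x))" for u
  define g where "g N = sum q (length_words (n i) N)" for N
  have Ti: "\<forall>s\<in>{1..n i}. bounded_clinear (T i s)" using T i by blast
  have h: "h u = q u - (\<Sum>s\<in>{1..n i}. q (u @ [s]))" for u
    unfolding h_def q_def cinner_defect_Cons[of n i T, OF Ti] by simp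
  have "sum h (length_words (n i) N) = g N - g (Suc N)" for N
    unfolding h g_def sum_length_words_snoc sum_subtractf ..
  moreover have "sum h (\<Union>m<N. length_words (n i) m) = (\<Sum>m<N. sum h (length_words (n i) m))" for N
    by (rule sum.UNION_disjoint) (auto simp: finite_length_words, auto simp: length_words_def)
  ultimately have tel: "sum h (\<Union>m<N. length_words (n i) m) = g 0 - g N" for N
    by (simp add: sum_lessThan_telescope')
  obtain C where C: "\<And>y. cmod (cinner (D l y) y) \<le> C * (norm y)\<^sup>2"
    using bounded_clinear_form_bound[OF bounded_clinear_defect[of k n T, OF T l]] by blast
  \<comment> \<open>The form of \<open>D l\<close> is bounded, so the remainder is at most a
    constant times the form of the \<open>N\<close>-th power of \<open>Phi\<close> at the identity,
    and purity applies to that.\<close>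
  have bound: "norm (g N) \<le> \<bar>C\<bar> * (norm ((Phi n 1 T i ^^ N) (\<lambda>x. x) x) * norm x)" for N
  proof -
    have "norm (g N) \<le> (\<Sum>u\<in>length_words (n i) N. \<bar>C\<bar> * (norm (B i u x))\<^sup>2)"
      unfolding g_def
    proof (rule sum_norm_le)
      fix u
      have "norm (q u) \<le> C * (norm (B i u x))\<^sup>2"
        unfolding q_def real_norm_def by (rule order_trans[OF abs_Re_le_cmod C])
      also have "\<dots> \<le> \<bar>C\<bar> * (norm (B i u x))\<^sup>2" by (intro mult_right_mono) auto
      finally show "norm (q u) \<le> \<bar>C\<bar> * (norm (B i u x))\<^sup>2" .
    qed
    also have "\<dots> = \<bar>C\<bar> * (\<Sum>u\<in>length_words (n i) N. (norm (B i u x))\<^sup>2)" by (simp add: sum_distrib_left)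
    also have "(\<Sum>u\<in>length_words (n i) N. (norm (B i u x))\<^sup>2) = Re (cinner ((Phi n 1 T i ^^ N) (\<lambda>x. x) x) x)"
      unfolding cinner_Phi_power_words[OF i] cinner_self by simp
    also have "\<bar>C\<bar> * \<dots> \<le> \<bar>C\<bar> * (norm ((Phi n 1 T i ^^ N) (\<lambda>x. x) x) * norm x)"
      by (intro mult_left_mono order_trans[OF complex_Re_le_cmod cauchy_schwarz]) simp
    finally show ?thesis .
  qed
  have "(\<lambda>N. (Phi n 1 T i ^^ N) (\<lambda>x. x) x) \<longlonglongrightarrow> 0" using pure i unfolding pure_tuple_def by blast
  then have "(\<lambda>N. \<bar>C\<bar> * (norm ((Phi n 1 T i ^^ N) (\<lambda>x. x) x) * norm x)) \<longlonglongrightarrow> 0"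
    by (intro tendsto_mult_right_zero tendsto_mult_left_zero tendsto_norm_zero)
  then have "g \<longlonglongrightarrow> 0" by (rule Lim_null_comparison[rotated]) (use bound in simp)
  then have "(\<lambda>N. g 0 - g N) \<longlonglongrightarrow> g 0 - 0" by (intro tendsto_intros)
  moreover have "g 0 = Re (cinner (D l x) x)" by (simp add: g_def q_def)
  ultimately show "(\<lambda>N. sum (\<lambda>u. Re (cinner (D (i # l) (B i u x)) (B i u x))) (\<Union>m<N. length_words (n i) m))
      \<longlonglongrightarrow> Re (cinner (D l x) x)"
    using tel unfolding h_def[symmetric] by simp
  fix G assume G: "finite G" "G \<subseteq> lists {1..n i}"
  \<comment> \<open>The longest word of \<open>G\<close> decides; the inserted 0 covers an empty
    \<open>G\<close>.\<close>
  have "G \<subseteq> (\<Union>m<Suc (Max (insert 0 (length ` G))). length_words (n i) m)"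
  proof
    fix u assume u: "u \<in> G"
    then have "length u \<le> Max (insert 0 (length ` G))" using G by (intro Max_ge) auto
    then show "u \<in> (\<Union>m<Suc (Max (insert 0 (length ` G))). length_words (n i) m)"
      using u G by (auto simp: length_words_def less_Suc_eq_le in_lists_conv_set)
  qed
  then show "\<exists>N. G \<subseteq> (\<Union>m<N. length_words (n i) m)" by blast
qed (auto simp: finite_length_words pos, auto simp: length_words_def)

text \<open>Summing over the \<open>i\<close>-th word turns \<open>D (i # l)\<close> into
  \<open>D l\<close>, and the remaining words are summed by induction. The head acts on the vector
  produced by the tail, hence \<open>foldr\<close>.\<close>

lemma iterated_has_sum:
  assumes "set l \<subseteq> {1..k}" "distinct l" "\<And>y. 0 \<le> Re (cinner (D l y) y)"
  shows "((\<lambda>w. Re (cinner (D l (foldr (\<lambda>i. B i (w i)) l x)) (foldr (\<lambda>i. B i (w i)) l x)))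
    has_sum (norm x)\<^sup>2) (\<Pi>\<^sub>E i\<in>set l. lists {1..n i})"
  using assms
proof (induction l)
  case Nil
  then show ?case by (simp add: cinner_self has_sum_finiteI)
next
  case (Cons i l)
  then have i: "i \<in> {1..k}" "i \<notin> set l" and l: "set l \<subseteq> {1..k}" "distinct l" by auto
  let ?P = "\<Pi>\<^sub>E j\<in>set l. lists {1..n j}"
  let ?y = "\<lambda>w. foldr (\<lambda>j. B j (w j)) l x"
  define f where "f = (\<lambda>(w, u). Re (cinner (D (i # l) (B i u (?y w))) (B i u (?y w))))"
  have inner: "((\<lambda>u. f (w, u)) has_sum Re (cinner (D l (?y w)) (?y w))) (lists {1..n i})" for w
    unfolding f_def prod.case by (rule defect_has_sum[OF i(1) l(1) Cons.prems(3)])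
  \<comment> \<open>Positivity is given only for the longer list; \<open>D l\<close> inherits it as
    a sum of nonnegative terms.\<close>
  have "0 \<le> Re (cinner (D l y) y)" for y
    using defect_has_sum[OF i(1) l(1) Cons.prems(3)] by (rule has_sum_nonneg) (rule Cons.prems(3))
  then have outer: "((\<lambda>w. Re (cinner (D l (?y w)) (?y w))) has_sum (norm x)\<^sup>2) ?P"
    by (intro Cons.IH l)
  \<comment> \<open>Tonelli: since the terms are nonnegative, convergence of the iterated sum
    suffices.\<close>
  have "f summable_on Sigma ?P (\<lambda>_. lists {1..n i})"
    using inner has_sum_imp_summable[OF outer] by (rule summable_on_SigmaI) (auto simp: f_def Cons.prems(3))
  with inner outer have "(f has_sum (norm x)\<^sup>2) (Sigma ?P (\<lambda>_. lists {1..n i}))"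
    by (rule has_sum_SigmaI)
  moreover have "bij_betw (\<lambda>(w, u). w(i := u)) (Sigma ?P (\<lambda>_. lists {1..n i})) (\<Pi>\<^sub>E j\<in>set (i # l). lists {1..n j})"
    using bij_betw_PiE_upd[OF i(2)] by simp
  moreover have "?y (w(i := u)) = ?y w" for w u
    using i(2) by (intro foldr_cong) auto
  ultimately show ?case
    by (subst has_sum_reindex_bij_betw[symmetric]) (auto simp: f_def case_prod_unfold)
qed

section \<open>Commutation phases along words\<close>

lemma adjoint_commutation:
  assumes i: "i \<in> {1..k}" "s \<in> {1..n i}" and j: "j \<in> {1..k}" "t \<in> {1..n j}" and ij: "i \<noteq> j"
  shows "A j t (A i s x) = cnj (lam i j s t) *\<^sub>C A i s (A j t x)"
proof -
  have c: "T i s (T j t z) = lam i j s t *\<^sub>C T j t (T i s z)" for z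
    using regular i j ij unfolding regular_polyball_def by blast
  have Ti: "bounded_clinear (T i s)" and Tj: "bounded_clinear (T j t)" using T i j by auto
  show ?thesis
    by (rule cinner_eqI_right)
      (simp add: c cinner_scaleC_left cinner_scaleC_right flip: cinner_cadjoint[OF Ti] cinner_cadjoint[OF Tj])
qed

lemma B_A_commute:
  assumes i: "i \<in> {1..k}" "s \<in> {1..n i}" and j: "j \<in> {1..k}" and ij: "i \<noteq> j" and u: "u \<in> lists {1..n j}"
  shows "B j u (A i s x) = cnj (lam_word lam i j s u) *\<^sub>C A i s (B j u x)"
  using u
proof (induction u arbitrary: x)
  case Nil
  then show ?case by (simp add: lam_word_def scaleC_one)
next
  case (Cons t u)
  have t: "t \<in> {1..n j}" and u: "u \<in> lists {1..n j}" using Cons.hyps by auto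
  have "B j (t # u) (A i s x) = cnj (lam i j s t) *\<^sub>C B j u (A i s (A j t x))"
    by (simp add: adjoint_commutation[OF i j t ij] bounded_clinearD[OF bounded_clinear_B[OF j u]])
  also have "B j u (A i s (A j t x)) = cnj (lam_word lam i j s u) *\<^sub>C A i s (B j u (A j t x))"
    by (rule Cons.IH)
  finally show ?case by (simp add: lam_word_def scaleC_scaleC)
qed

text \<open>Only the existence of a unimodular factor is recorded, since it is used under an
  absolute value.\<close>

lemma B_B_commute:
  assumes i: "i \<in> {1..k}" and j: "j \<in> {1..k}" and ij: "i \<noteq> j" and u: "u \<in> lists {1..n j}" and v: "v \<in> lists {1..n i}"
  shows "\<exists>c. cmod c = 1 \<and> (\<forall>x. B j u (B i v x) = c *\<^sub>C B i v (B j u x))"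
  using v
proof induction
  case Nil
  show ?case by (intro exI[of _ 1]) (simp add: scaleC_one)
next
  case (Cons s v)
  then obtain c where c: "cmod c = 1" "\<And>x. B j u (B i v x) = c *\<^sub>C B i v (B j u x)" by blast
  let ?d = "cnj (lam_word lam i j s u)"
  have "B j u (B i (s # v) x) = (c * ?d) *\<^sub>C B i (s # v) (B j u x)" for x
    using c(2) by (simp add: B_A_commute[OF i Cons(1) j ij u] bounded_clinearD[OF bounded_clinear_B[OF i Cons(2)]] scaleC_scaleC)
  moreover have "cmod (c * ?d) = 1" using c(1) cmod_lam_word[OF L i j ij Cons(1) u] by (simp add: norm_mult)
  ultimately show ?case by blast
qed

text \<open>On \<open>[1..<Suc k]\<close> this is the adjoint of the product of the words in
  increasing order of index, so index 1 acts first, as the phases of the model demand.\<close>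

definition word_action :: "(nat \<Rightarrow> nat list) \<Rightarrow> nat list \<Rightarrow> 'h \<Rightarrow> 'h"
  where "word_action w l = fold (\<lambda>i. B i (w i)) l"

lemma word_action_simps [simp]:
  "word_action w [] x = x" "word_action w (i # l) x = word_action w l (B i (w i) x)"
  "word_action w (l @ l') x = word_action w l' (word_action w l x)"
  by (simp_all add: word_action_def)

lemma bounded_clinear_word_action:
  "w \<in> words k n \<Longrightarrow> set l \<subseteq> {1..k} \<Longrightarrow> bounded_clinear (word_action w l)"
proof (induction l)
  case (Cons i l)
  then have "bounded_clinear (\<lambda>x. word_action w l (B i (w i) x))"
    using bounded_clinear_compose[of "word_action w l" "B i (w i)"] bounded_clinear_B words_entry by auto
  then show ?case by (simp add: word_action_def comp_def)
qed (simp add: word_action_def bounded_clinear_ident id_def)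

lemma word_action_B:
  assumes w: "w \<in> words k n" and i: "i \<in> {1..k}" and v: "v \<in> lists {1..n i}"
  shows "set l \<subseteq> {1..k} - {i} \<Longrightarrow> \<exists>c. cmod c = 1 \<and> (\<forall>x. word_action w l (B i v x) = c *\<^sub>C B i v (word_action w l x))"
proof (induction l)
  case Nil
  show ?case by (intro exI[of _ 1]) (simp add: scaleC_one)
next
  case (Cons j l)
  then have j: "j \<in> {1..k}" "i \<noteq> j" and l: "set l \<subseteq> {1..k}" by auto
  obtain c where c: "cmod c = 1" "\<And>x. B j (w j) (B i v x) = c *\<^sub>C B i v (B j (w j) x)"
    using B_B_commute[OF i j words_entry[OF w j(1)] v] by blast
  obtain d where d: "cmod d = 1" "\<And>x. word_action w l (B i v x) = d *\<^sub>C B i v (word_action w l x)"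
    using Cons by auto
  have "word_action w (j # l) (B i v x) = (c * d) *\<^sub>C B i v (word_action w (j # l) x)" for x
    by (simp add: c d bounded_clinearD[OF bounded_clinear_word_action[OF w l]] scaleC_scaleC)
  then show ?case using c(1) d(1) by (intro exI[of _ "c * d"]) (simp add: norm_mult)
qed

text \<open>The isometry property comes out for the opposite order of the factors; by the commutation
  relations the order only affects phases.\<close>

lemma word_action_foldr:
  assumes w: "w \<in> words k n"
  shows "set l \<subseteq> {1..k} \<Longrightarrow> distinct l \<Longrightarrow>
    \<exists>c. cmod c = 1 \<and> (\<forall>x. word_action w l x = c *\<^sub>C foldr (\<lambda>i. B i (w i)) l x)"
proof (induction l)
  case Nil
  show ?case by (intro exI[of _ 1]) (simp add: scaleC_one)
next
  case (Cons i l)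
  then have i: "i \<in> {1..k}" and l: "set l \<subseteq> {1..k} - {i}" by auto
  note wi = words_entry[OF w i]
  obtain c where c: "cmod c = 1" "\<And>x. word_action w l (B i (w i) x) = c *\<^sub>C B i (w i) (word_action w l x)"
    using word_action_B[OF w i wi l] by blast
  obtain d where d: "cmod d = 1" "\<And>x. word_action w l x = d *\<^sub>C foldr (\<lambda>i. B i (w i)) l x"
    using Cons by auto
  have "word_action w (i # l) x = (c * d) *\<^sub>C foldr (\<lambda>i. B i (w i)) (i # l) x" for x
    by (simp add: c, simp add: d bounded_clinearD[OF bounded_clinear_B[OF i wi]] scaleC_scaleC)
  then show ?case using c(1) d(1) by (intro exI[of _ "c * d"]) (simp add: norm_mult)
qed

text \<open>Here the exact phase counts, because it has to agree with the phase of the model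
  shift.\<close>

lemma word_action_A:
  assumes w: "w \<in> words k n" and i: "i \<in> {1..k}" "s \<in> {1..n i}"
  shows "set l \<subseteq> {1..k} - {i} \<Longrightarrow>
    word_action w l (A i s x) = cnj (\<Prod>j\<leftarrow>l. lam_word lam i j s (w j)) *\<^sub>C A i s (word_action w l x)"
proof (induction l arbitrary: x)
  case (Cons j l)
  then have j: "j \<in> {1..k}" "i \<noteq> j" and l: "set l \<subseteq> {1..k}" "set l \<subseteq> {1..k} - {i}" by auto
  show ?case
    by (simp add: B_A_commute[OF i j words_entry[OF w j(1)]] Cons.IH[OF l(2)]
        bounded_clinearD[OF bounded_clinear_word_action[OF w l(1)]] scaleC_scaleC)
qed (simp add: scaleC_one)

text \<open>The adjoint of \<open>T i s\<close> moves past the factors of index below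
  \<open>i\<close>, collecting the conjugate of \<open>shift_phase\<close>, and becomes the first
  letter of the \<open>i\<close>-th word. It never meets the factors above \<open>i\<close>.\<close>

lemma word_action_shift:
  assumes w: "w \<in> words k n" and i: "i \<in> {1..k}" "s \<in> {1..n i}"
  shows "word_action w [1..<Suc k] (A i s x)
    = cnj (shift_phase lam i s w) *\<^sub>C word_action (w(i := s # w i)) [1..<Suc k] x"
proof -
  have split: "[1..<Suc k] = [1..<i] @ i # [Suc i..<Suc k]"
    using i upt_add_eq_append[of 1 i "Suc k - i"] upt_conv_Cons[of i "Suc k"] by simp
  have cong: "word_action (w(i := s # w i)) l = word_action w l" if "i \<notin> set l" for l
    unfolding word_action_def using that by (intro ext fold_cong) auto
  have ph: "shift_phase lam i s w = (\<Prod>j\<leftarrow>[1..<i]. lam_word lam i j s (w j))"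
    unfolding shift_phase_def by (subst prod.distinct_set_conv_list[symmetric]) auto
  have "set [Suc i..<Suc k] \<subseteq> {1..k}" by auto
  note lin = bounded_clinearD(4)[OF bounded_clinear_word_action[OF w this]]
    bounded_clinearD(4)[OF bounded_clinear_B[OF i(1) words_entry[OF w i(1)]]]
  have "word_action w [1..<i] (A i s x) = cnj (shift_phase lam i s w) *\<^sub>C A i s (word_action w [1..<i] x)"
    unfolding ph using i by (intro word_action_A[OF w i]) auto
  then show ?thesis unfolding split by (simp add: cong lin del: upt_Suc)
qed

section \<open>The isometric embedding and its range\<close>

lemma isometric_embedding:
  assumes v: "\<And>x. Delta k n 1 T x = cinner x v *\<^sub>C v"
  shows "((\<lambda>w. (cmod (cinner (word_action w [1..<Suc k] x) v))\<^sup>2) has_sum (norm x)\<^sup>2) (words k n)"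
proof -
  let ?L = "[1..<Suc k]"
  have setL: "set ?L \<subseteq> {1..k}" by auto
  have D: "D ?L y = cinner y v *\<^sub>C v" for y using v by (simp only: Delta_eq_defect)
  \<comment> \<open>The terms left by telescoping are thus squared moduli of coordinates, up to
    phases.\<close>
  have Dy: "Re (cinner (D ?L y) y) = (cmod (cinner y v))\<^sup>2" for y
  proof -
    have "cinner (D ?L y) y = cinner y v * cnj (cinner y v)"
      unfolding D cinner_scaleC_left cinner_commute[of v y] ..
    also have "\<dots> = complex_of_real ((cmod (cinner y v))\<^sup>2)" by (rule complex_norm_square[symmetric])
    finally show ?thesis by simp
  qed
  have "((\<lambda>w. (cmod (cinner (foldr (\<lambda>i. B i (w i)) ?L x) v))\<^sup>2) has_sum (norm x)\<^sup>2)
      (\<Pi>\<^sub>E i\<in>set ?L. lists {1..n i})"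
    unfolding Dy[symmetric]
  proof (rule iterated_has_sum)
    show "0 \<le> Re (cinner (D ?L y) y)" for y unfolding Dy by simp
  qed auto
  moreover have "(\<Pi>\<^sub>E i\<in>set ?L. lists {1..n i}) = words k n"
    unfolding words_def by (intro PiE_cong arg_cong2[where f = PiE]) auto
  moreover have "cmod (cinner (word_action w ?L x) v) = cmod (cinner (foldr (\<lambda>i. B i (w i)) ?L x) v)"
    if w: "w \<in> words k n" for w
  proof -
    obtain c where "cmod c = 1" "word_action w ?L x = c *\<^sub>C foldr (\<lambda>i. B i (w i)) ?L x"
      using word_action_foldr[OF w setL distinct_upt] by blast
    then show ?thesis by (simp add: cinner_scaleC_left norm_mult del: upt_Suc)
  qed
  ultimately show ?thesis by (subst has_sum_cong[where g = "\<lambda>w. (cmod (cinner (foldr (\<lambda>i. B i (w i)) ?L x) v))\<^sup>2"]) auto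
qed

lemma equivalent_to_compression:
  assumes rank: "rank_op (Delta k n 1 T) = 1"
  shows "\<exists>M. coinvariant k n lam M \<and> unitarily_equivalent k n UNIV T M (compression M (std_shift k n lam))"
proof -
  let ?L = "[1..<Suc k]"
  have setL: "set ?L \<subseteq> {1..k}" by auto
  have "positive_op (D ?L)"
    using regular unfolding regular_polyball_def Delta_eq_defect
    by (intro positive_defect_one[of k n T, OF T setL]) blast
  then obtain v where v: "\<And>x. Delta k n 1 T x = cinner x v *\<^sub>C v"
    using rank_one_positive[OF bounded_clinear_defect[of k n T, OF T setL] _ defect_selfadjoint[of k n T, OF T setL]]
      rank unfolding Delta_eq_defect by blast
  \<comment> \<open>The ambient index set is larger than \<open>words k n\<close>; the value 0
    outside places \<open>K x\<close> in the Fock space.\<close>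
  define c where "c x w = (if w \<in> words k n then cinner (word_action w ?L x) v else 0)" for x w
  have c_sum: "((\<lambda>w. (cmod (c x w))\<^sup>2) has_sum (norm x)\<^sup>2) UNIV" for x
    using isometric_embedding[OF v, of x]
    by (subst has_sum_cong_neutral[where g = "\<lambda>w. (cmod (cinner (word_action w ?L x) v))\<^sup>2" and T = "words k n"])
      (auto simp: c_def simp del: upt_Suc One_nat_def)
  define K where "K x = Abs_ell2 (c x)" for x
  have coord_K: "coord (K x) = c x" for x
    unfolding K_def using has_sum_imp_summable[OF c_sum] by (intro Abs_ell2_inverse) simp
  have "(norm (K x))\<^sup>2 = (norm x)\<^sup>2" for x
    unfolding norm_ell2_power2 coord_K by (rule infsumI[OF c_sum])
  then have norm_K: "norm (K x) = norm x" for x by (simp add: power2_eq_iff_nonneg)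
  note lin = bounded_clinearD[OF bounded_clinear_word_action[OF _ setL]]
  have K_add: "K (x + y) = K x + K y" for x y
    by (rule ell2_eqI) (auto simp: coord_K plus_ell2.rep_eq c_def lin cinner_add_left simp del: upt_Suc One_nat_def)
  have K_scale: "K (a *\<^sub>C x) = a *\<^sub>C K x" for a x
    by (rule ell2_eqI) (simp add: coord_K scaleC_ell2.rep_eq c_def lin cinner_scaleC_left del: upt_Suc One_nat_def)
  have K_cinner: "cinner (K x) (K y) = cinner x y" for x y
    by (rule isometry_cinner[OF K_add K_scale norm_K])
  have K_adj: "K (A i s x) = cadjoint (std_shift k n lam i s) (K x)" if i: "i \<in> {1..k}" "s \<in> {1..n i}" for i s x
  proof (rule ell2_eqI)
    fix w
    show "coord (K (A i s x)) w = coord (cadjoint (std_shift k n lam i s) (K x)) w"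
    proof (cases "w \<in> words k n")
      case True
      have "w(i := s # w i) \<in> words k n" using words_upd[OF True i(1)] words_entry[OF True i(1)] i by auto
      then show ?thesis using True
        by (simp add: coord_cadjoint_std_shift[OF L i] coord_K c_def word_action_shift[OF True i] cinner_scaleC_left
            del: upt_Suc One_nat_def)
    qed (simp add: coord_cadjoint_std_shift[OF L i] coord_K c_def)
  qed
  define M where "M = range K"
  have "bounded_linear K"
    by (rule bounded_linear_intro[where K = 1]) (simp_all add: K_add scaleR_scaleC K_scale norm_K)
  then have "complete M"
    unfolding M_def using complete_isometric_image[of 1 UNIV K] by (simp add: norm_K complete_UNIV)
  then have "closed M" by (rule complete_imp_closed)
  moreover have "csubspace M"
  proof (rule complex_vector.subspaceI)
    have "K 0 = 0" using norm_K[of 0] by simp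
    then show "0 \<in> M" unfolding M_def by (metis rangeI)
  qed (auto simp: M_def simp flip: K_add K_scale)
  ultimately have M_closed: "closed_csubspace M" by (simp add: closed_csubspace_def)
  have M: "coinvariant k n lam M"
    unfolding coinvariant_def
    by (auto simp: M_closed) (auto simp: M_def fock_def coord_K c_def simp flip: K_adj)
  have "K (T i s x) = compression M (std_shift k n lam) i s (K x)" if i: "i \<in> {1..k}" "s \<in> {1..n i}" for i s x
  proof -
    \<comment> \<open>\<open>K\<close> intertwines only the adjoints, so the identity for
      \<open>T i s\<close> is tested against \<open>K y\<close>, where both terms give
      \<open>cinner x (A i s y)\<close>. The difference lies in \<open>M\<close>, hence is
      0.\<close>
    let ?d = "K (T i s x) - compression M (std_shift k n lam) i s (K x)"
    have Ti: "bounded_clinear (T i s)" using T i by blast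
    have KM: "K y \<in> M" for y by (simp add: M_def)
    have orth: "cinner ?d (K y) = 0" for y
      by (simp add: cinner_diff_left cinner_compression[OF L M i KM] K_cinner cinner_cadjoint[OF Ti] flip: K_adj[OF i])
    have "?d \<in> M" by (intro closed_csubspaceD[OF M_closed] KM compression_in[OF M])
    then have "cinner ?d ?d = 0" using orth by (auto simp: M_def)
    then show ?thesis by (simp add: cinner_self)
  qed
  moreover have "unitary_onto UNIV M K"
    unfolding unitary_onto_def by (simp add: K_add K_scale K_cinner M_def)
  ultimately have "unitarily_equivalent k n UNIV T M (compression M (std_shift k n lam))"
    unfolding unitarily_equivalent_def by blast
  then show ?thesis using M by blast
qed

end

theorem corollary5p8:
  fixes k :: nat and n :: "nat \<Rightarrow> nat"
    and lam :: "nat \<Rightarrow> nat \<Rightarrow> nat \<Rightarrow> nat \<Rightarrow> complex"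
    and T :: "nat \<Rightarrow> nat \<Rightarrow> 'h::chilbert_space \<Rightarrow> 'h"
  assumes "1 \<le> k" and "\<forall>i\<in>{1..k}. 1 \<le> n i"
    and "Lambda_system k n lam"
    and nontrivial: "\<exists>x::'h. x \<noteq> 0"
    and "\<forall>i\<in>{1..k}. \<forall>s\<in>{1..n i}. bounded_clinear (T i s)"
  shows "(T \<in> regular_polyball k n lam \<and> pure_tuple k n T \<and> rank_op (Delta k n 1 T) = 1 \<longleftrightarrow>
      (\<exists>M. coinvariant k n lam M \<and> unitarily_equivalent k n UNIV T M (compression M (std_shift k n lam))))
    \<and> (\<forall>M M'. coinvariant k n lam M \<and> coinvariant k n lam M' \<longrightarrow>
      (unitarily_equivalent k n M (compression M (std_shift k n lam)) M' (compression M' (std_shift k n lam)) \<longleftrightarrow> M = M'))"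
proof (intro conjI iffI allI impI)
  assume "T \<in> regular_polyball k n lam \<and> pure_tuple k n T \<and> rank_op (Delta k n 1 T) = 1"
  then interpret pure_element k n lam T
    using assms(3) by unfold_locales auto
  show "\<exists>M. coinvariant k n lam M \<and> unitarily_equivalent k n UNIV T M (compression M (std_shift k n lam))"
    using \<open>_ \<and> _ \<and> rank_op _ = 1\<close> by (intro equivalent_to_compression) simp
next
  assume "\<exists>M. coinvariant k n lam M \<and> unitarily_equivalent k n UNIV T M (compression M (std_shift k n lam))"
  then obtain U where "fock_model k n lam T U"
    using fock_model_of_equivalence[OF assms(3,5)] by blast
  then interpret fock_model k n lam T U .
  show "T \<in> regular_polyball k n lam" "pure_tuple k n T" "rank_op (Delta k n 1 T) = 1"
    by (rule regular pure rank_one[OF nontrivial])+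
next
  fix M M'
  assume M: "coinvariant k n lam M \<and> coinvariant k n lam M'"
  show "M = M'" if "unitarily_equivalent k n M (compression M (std_shift k n lam)) M' (compression M' (std_shift k n lam))"
    using coinvariant_unique[OF assms(3) _ _ that] M by blast
  show "unitarily_equivalent k n M (compression M (std_shift k n lam)) M' (compression M' (std_shift k n lam))"
    if "M = M'"
    unfolding unitarily_equivalent_def unitary_onto_def using that by (intro exI[of _ "\<lambda>x. x"]) simp
qed

end
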